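(* Let $k\ge 2$ be fixed, $N=kn$, and $p=\Omega(1/\log n)$. Let $G$ be a random graph from the $G(N,p)$ model conditioned on being connected, and let $T$ be a uniformly random spanning tree of $G$. Then the probability that $T$ is $k$-splittable is at least $C_k\, n^{\frac{1-k}{2}}\, p\, e^{-(2+o(1))/p}$, and in particular at least $C_k n^{-\frac k2-O(1)}$, where $C_k>0$ depends only on $k$ and $o(1)\to0$ as $n\to\infty$.
   Context: A tree $T$ is $k$-splittable if there exist $k-1$ edges of $T$ whose removal leaves a forest whose $k$ connected components all have the same number of vertices. $G(N,p)$ is the random graph on $N$ labeled vertices in which each edge is present independently with probability $p$. The probability is taken over both $G$ and $T$, i.e. it equals $\mathbb{E}_G[\tau_k(G)/\tau(G)]$, where $\tau(G)$ is the number of spanning trees of $G$ and $\tau_k(G)$ the number of $k$-splittable spanning trees of $G$. *)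

theory Defs
  imports Complex_Main
begin

section \<open>Graphs on the vertex set {0..<N}\<close>

text \<open>An edge is a two-element set of vertices.  The complete graph on {0..<N}.\<close>
definition all_edges :: "nat \<Rightarrow> nat set set" where
  "all_edges N = {e. \<exists>u v. u < N \<and> v < N \<and> u \<noteq> v \<and> e = {u, v}}"

text \<open>Adjacency relation of the graph (V, F).\<close>
definition adj_rel :: "nat set \<Rightarrow> nat set set \<Rightarrow> (nat \<times> nat) set" where
  "adj_rel V F = {(u, v). u \<in> V \<and> v \<in> V \<and> u \<noteq> v \<and> {u, v} \<in> F}"

definition connected_graph :: "nat set \<Rightarrow> nat set set \<Rightarrow> bool" where
  "connected_graph V F \<longleftrightarrow> (\<forall>u\<in>V. \<forall>v\<in>V. (u, v) \<in> (adj_rel V F)\<^sup>*)"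

text \<open>Connected components of (V, F).\<close>
definition components :: "nat set \<Rightarrow> nat set set \<Rightarrow> nat set set" where
  "components V F = V // ((adj_rel V F)\<^sup>*)"

text \<open>A cycle: a list of at least three distinct vertices, consecutive ones adjacent,
  and the last adjacent to the first.\<close>
definition has_cycle :: "nat set \<Rightarrow> nat set set \<Rightarrow> bool" where
  "has_cycle V F \<longleftrightarrow> (\<exists>vs. length vs \<ge> 3 \<and> distinct vs \<and> set vs \<subseteq> V \<and>
      (\<forall>i < length vs - 1. {vs ! i, vs ! Suc i} \<in> F) \<and> {last vs, hd vs} \<in> F)"

text \<open>A tree on vertex set V with edge set F (edges inside V): connected and acyclic.\<close>
definition is_tree :: "nat set \<Rightarrow> nat set set \<Rightarrow> bool" where
  "is_tree V F \<longleftrightarrow> (\<forall>e\<in>F. \<exists>u v. u \<in> V \<and> v \<in> V \<and> u \<noteq> v \<and> e = {u, v})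
     \<and> connected_graph V F \<and> \<not> has_cycle V F"

text \<open>Spanning trees of a graph G on {0..<N}.\<close>
definition spanning_trees :: "nat \<Rightarrow> nat set set \<Rightarrow> nat set set set" where
  "spanning_trees N G = {T. T \<subseteq> G \<and> is_tree {0..<N} T}"

text \<open>k-splittable tree: removing some k-1 of its edges leaves a forest whose k
  connected components all have the same number of vertices.\<close>
definition k_splittable :: "nat \<Rightarrow> nat set \<Rightarrow> nat set set \<Rightarrow> bool" where
  "k_splittable k V T \<longleftrightarrow> (\<exists>S. S \<subseteq> T \<and> card S = k - 1 \<and>
      card (components V (T - S)) = k \<and>
      (\<forall>C1 \<in> components V (T - S). \<forall>C2 \<in> components V (T - S). card C1 = card C2))"

definition tau :: "nat \<Rightarrow> nat set set \<Rightarrow> nat" where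
  "tau N G = card (spanning_trees N G)"

definition tau_k :: "nat \<Rightarrow> nat \<Rightarrow> nat set set \<Rightarrow> nat" where
  "tau_k k N G = card {T \<in> spanning_trees N G. k_splittable k {0..<N} T}"

section \<open>G(N,p) conditioned on connectivity\<close>

definition gnp_weight :: "nat \<Rightarrow> real \<Rightarrow> nat set set \<Rightarrow> real" where
  "gnp_weight N p G = p ^ card G * (1 - p) ^ (card (all_edges N) - card G)"

definition connected_graphs :: "nat \<Rightarrow> nat set set set" where
  "connected_graphs N = {G. G \<subseteq> all_edges N \<and> connected_graph {0..<N} G}"

text \<open>Probability that a uniformly random spanning tree of G ~ G(N,p), conditioned on
  G being connected, is k-splittable:  E[tau_k(G)/tau(G) | G connected].\<close>
definition splittable_prob :: "nat \<Rightarrow> nat \<Rightarrow> real \<Rightarrow> real" where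
  "splittable_prob k N p =
     (\<Sum>G\<in>connected_graphs N. gnp_weight N p G * (real (tau_k k N G) / real (tau N G)))
     / (\<Sum>G\<in>connected_graphs N. gnp_weight N p G)"

end

theory Submission
  imports Defs "HOL-Library.FuncSet" "HOL-Combinatorics.Multiset_Permutations"
begin

text \<open>
  Write \<open>s\<close> and \<open>t\<close> for the numbers of \<open>k\<close>-splittable and of all spanning trees of
  \<open>G(N,p)\<close>.  Since \<open>s / t \<ge> 2 L s - L\<^sup>2 s t\<close> for every \<open>L\<close>, the first moment of \<open>s\<close> and an
  upper bound on the mixed moment of \<open>s\<close> and \<open>t\<close> suffice.  For a fixed tree \<open>T\<close>, expanding
  \<open>(1/p) ^ card (T \<inter> T')\<close> with \<open>1/p = 1 + q\<close> over the subsets \<open>F\<close> of \<open>T \<inter> T'\<close> turns the sum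
  over all trees \<open>T'\<close> into the sum of \<open>q ^ card F\<close> times the number of trees containing the
  forest \<open>F \<subseteq> T\<close>.  If \<open>F\<close> has \<open>m\<close> components \<open>C\<close>, that number is
  \<open>N ^ (m - 2) * (\<Prod>C. card C) \<le> N ^ (N - 2) * (2 / N) ^ card F\<close>, because
  \<open>card C \<le> 2 ^ (card C - 1)\<close>; hence the sum is at most \<open>N ^ (N - 2) * exp (2 q)\<close>.
  The probability is therefore at least \<open>exp (- 2 q)\<close> times the proportion of
  \<open>k\<close>-splittable trees in the complete graph.  A tree splits into \<open>k\<close> equal parts in at most
  one way, so this proportion can be counted exactly: it is the multinomial probability
  \<open>(k n)! / (n! ^ k * k ^ (k n))\<close> up to a factor depending only on \<open>k\<close>.
\<close>

section \<open>Components and forests\<close>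

definition edges_on :: "nat set \<Rightarrow> nat set set" where
  "edges_on V = {e. \<exists>u v. u \<in> V \<and> v \<in> V \<and> u \<noteq> v \<and> e = {u, v}}"

text \<open>Reflexive on all naturals, so an equivalence on \<open>UNIV\<close>: a vertex outside
  \<open>V\<close> is alone in its class, and classes of vertices of \<open>V\<close> stay in
  \<open>V\<close> by \<open>conn_in\<close>.\<close>

definition conn :: "nat set \<Rightarrow> nat set set \<Rightarrow> (nat \<times> nat) set" where
  "conn V F = (adj_rel V F)\<^sup>*"

definition comp_of :: "nat set \<Rightarrow> nat set set \<Rightarrow> nat \<Rightarrow> nat set" where
  "comp_of V F u = conn V F `` {u}"

text \<open>Acyclicity is encoded by Euler's count, which makes inductions over single edges purely
  arithmetical. For finite \<open>V\<close>, \<open>forest_no_cycle\<close> and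
  \<open>no_cycle_forest\<close> identify it with the absence of cycles.\<close>

definition forest :: "nat set \<Rightarrow> nat set set \<Rightarrow> bool" where
  "forest V F \<longleftrightarrow> F \<subseteq> edges_on V \<and> card F + card (components V F) = card V"

lemma all_edges_eq: "all_edges N = edges_on {0..<N}"
  by (auto simp: all_edges_def edges_on_def)

lemma finite_edges_on: "finite V \<Longrightarrow> finite (edges_on V)"
  by (rule finite_subset[of _ "Pow V"]) (auto simp: edges_on_def)

lemma edges_onI: "u \<in> V \<Longrightarrow> v \<in> V \<Longrightarrow> u \<noteq> v \<Longrightarrow> {u, v} \<in> edges_on V"
  by (auto simp: edges_on_def)

lemma edges_onD: "{u, v} \<in> edges_on V \<Longrightarrow> u \<in> V \<and> v \<in> V \<and> u \<noteq> v"
  by (auto simp: edges_on_def doubleton_eq_iff)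

lemma sym_adj_rel: "sym (adj_rel V F)"
  by (auto simp: adj_rel_def sym_def insert_commute)

lemma conn_refl [simp]: "(u, u) \<in> conn V F"
  by (simp add: conn_def)

lemma conn_sym: "(u, v) \<in> conn V F \<Longrightarrow> (v, u) \<in> conn V F"
  using sym_rtrancl[OF sym_adj_rel] by (auto simp: conn_def sym_def)

lemma conn_trans: "(u, v) \<in> conn V F \<Longrightarrow> (v, w) \<in> conn V F \<Longrightarrow> (u, w) \<in> conn V F"
  by (simp add: conn_def)

lemma equiv_conn: "equiv UNIV (conn V F)"
  by (intro equivI) (auto simp: refl_on_def sym_def trans_def intro: conn_sym conn_trans)

lemma conn_in: "(u, v) \<in> conn V F \<Longrightarrow> u \<in> V \<Longrightarrow> v \<in> V"
  unfolding conn_def by (induction rule: rtrancl_induct) (auto simp: adj_rel_def)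

lemma conn_mono: "F \<subseteq> F' \<Longrightarrow> conn V F \<subseteq> conn V F'"
  unfolding conn_def by (intro rtrancl_mono) (auto simp: adj_rel_def)

lemma conn_edge: "{u, v} \<in> F \<Longrightarrow> F \<subseteq> edges_on V \<Longrightarrow> (u, v) \<in> conn V F"
  using edges_onD[of u v V] unfolding conn_def
  by (intro r_into_rtrancl) (auto simp: adj_rel_def)

lemma conn_closed:
  assumes "(u, v) \<in> conn V F" "\<And>x y. {x, y} \<in> F \<Longrightarrow> f x = f y"
  shows "f u = f v"
  using assms(1) unfolding conn_def
  by (induction rule: rtrancl_induct) (use assms(2) in \<open>auto simp: adj_rel_def\<close>)

text \<open>A walk need cross the new edge at most once, in one of the two directions.\<close>

lemma conn_insert:
  assumes "u \<in> V" "v \<in> V" "u \<noteq> v"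
  shows "(x, y) \<in> conn V (insert {u, v} F) \<longleftrightarrow> (x, y) \<in> conn V F \<or>
    (x, u) \<in> conn V F \<and> (v, y) \<in> conn V F \<or> (x, v) \<in> conn V F \<and> (u, y) \<in> conn V F"
    (is "_ \<longleftrightarrow> ?R x y")
proof
  have sub: "conn V F \<subseteq> conn V (insert {u, v} F)"
    by (intro conn_mono) auto
  have uv: "(u, v) \<in> conn V (insert {u, v} F)"
    using assms unfolding conn_def by (intro r_into_rtrancl) (auto simp: adj_rel_def)
  show "?R x y \<Longrightarrow> (x, y) \<in> conn V (insert {u, v} F)"
    using sub uv conn_sym[OF uv] conn_trans by (meson subsetD)
  assume "(x, y) \<in> conn V (insert {u, v} F)"
  then show "?R x y"
    unfolding conn_def[of V "insert {u, v} F"]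
  proof (induction rule: rtrancl_induct)
    case (step y z)
    then consider "(y, z) \<in> adj_rel V F" | "y = u" "z = v" | "y = v" "z = u"
      by (auto simp: adj_rel_def doubleton_eq_iff)
    then show ?case
    proof cases
      case 1
      then have "(y, z) \<in> conn V F" by (auto simp: conn_def)
      then show ?thesis using step.IH conn_trans by meson
    qed (use step.IH in auto)
  qed simp
qed

lemma comp_of_eq_iff: "comp_of V F u = comp_of V F v \<longleftrightarrow> (u, v) \<in> conn V F"
  unfolding comp_of_def using eq_equiv_class_iff[OF equiv_conn] by auto

lemma in_comp_of: "v \<in> comp_of V F u \<longleftrightarrow> (u, v) \<in> conn V F"
  by (simp add: comp_of_def)

lemma components_eq: "components V F = comp_of V F ` V"
  by (auto simp: components_def comp_of_def conn_def quotient_def)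

lemma comp_of_subset: "u \<in> V \<Longrightarrow> comp_of V F u \<subseteq> V"
  using conn_in by (auto simp: in_comp_of)

lemma comp_of_eq_component: "C \<in> components V F \<Longrightarrow> u \<in> C \<Longrightarrow> comp_of V F u = C"
  by (metis comp_of_eq_iff components_eq conn_sym imageE in_comp_of)

lemma component_subset: "C \<in> components V F \<Longrightarrow> C \<subseteq> V"
  using comp_of_subset by (auto simp: components_eq)

lemma component_nonempty: "C \<in> components V F \<Longrightarrow> C \<noteq> {}"
  by (metis components_eq conn_refl empty_iff imageE in_comp_of)

lemma finite_components: "finite V \<Longrightarrow> finite (components V F)"
  by (simp add: components_eq)

lemma card_component_pos: "finite V \<Longrightarrow> C \<in> components V F \<Longrightarrow> 0 < card C"
  using component_subset component_nonempty by (metis card_gt_0_iff finite_subset)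

lemma sum_over_components:
  fixes g :: "nat set \<Rightarrow> nat \<Rightarrow> 'a :: comm_monoid_add"
  assumes "finite V"
  shows "(\<Sum>u\<in>V. g (comp_of V F u) u) = (\<Sum>C\<in>components V F. \<Sum>u\<in>C. g C u)"
proof -
  have "(\<Sum>u\<in>V. g (comp_of V F u) u)
      = (\<Sum>C\<in>comp_of V F ` V. \<Sum>u | u \<in> V \<and> comp_of V F u = C. g (comp_of V F u) u)"
    by (rule sum.image_gen[OF assms])
  also have "\<dots> = (\<Sum>C\<in>components V F. \<Sum>u\<in>C. g C u)"
    unfolding components_eq
  proof (intro sum.cong[OF refl] sum.cong)
    fix C assume "C \<in> comp_of V F ` V"
    then have C: "C \<in> components V F" by (simp add: components_eq)
    show "{u \<in> V. comp_of V F u = C} = C"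
      using comp_of_eq_component[OF C] component_subset[OF C] conn_refl in_comp_of by blast
  next
    fix C u assume "C \<in> comp_of V F ` V" "u \<in> C"
    then show "g (comp_of V F u) u = g C u"
      using comp_of_eq_component[of C V F u] by (simp add: components_eq)
  qed
  finally show ?thesis .
qed

lemma sum_card_components:
  "finite V \<Longrightarrow> (\<Sum>C\<in>components V F. card C) = card V"
  using sum_over_components[of V "\<lambda>_ _. 1 :: nat" F] by simp

lemma card_components_uniform:
  assumes "finite V" "\<And>u. u \<in> V \<Longrightarrow> card (comp_of V F u) = n"
  shows "card (components V F) * n = card V"
proof -
  have "(\<Sum>C\<in>components V F. card C) = (\<Sum>C\<in>components V F. n)"
    using assms(2) by (intro sum.cong) (auto simp: components_eq)
  then show ?thesis using sum_card_components[OF assms(1), of F] by simp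
qed

section \<open>Effect of one additional edge on the components\<close>

lemma comp_of_insert:
  assumes "u \<in> V" "v \<in> V" "u \<noteq> v"
  shows "comp_of V (insert {u, v} F) x =
    (if x \<in> comp_of V F u \<union> comp_of V F v then comp_of V F u \<union> comp_of V F v
     else comp_of V F x)"
proof (rule set_eqI)
  fix y
  show "y \<in> comp_of V (insert {u, v} F) x \<longleftrightarrow> y \<in>
    (if x \<in> comp_of V F u \<union> comp_of V F v then comp_of V F u \<union> comp_of V F v
     else comp_of V F x)"
    unfolding in_comp_of conn_insert[OF assms] if_distrib[of "\<lambda>A. y \<in> A"] Un_iff
    by (smt (verit, best) conn_sym conn_trans)
qed

lemma components_insert:
  assumes "u \<in> V" "v \<in> V" "u \<noteq> v"
  shows "components V (insert {u, v} F) =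
    insert (comp_of V F u \<union> comp_of V F v) (components V F - {comp_of V F u, comp_of V F v})"
proof -
  let ?U = "comp_of V F u \<union> comp_of V F v"
  have out: "comp_of V F x \<notin> {comp_of V F u, comp_of V F v} \<longleftrightarrow> x \<notin> ?U" for x
    by (auto simp: comp_of_eq_iff in_comp_of intro: conn_sym)
  have "components V (insert {u, v} F) = (\<lambda>x. if x \<in> ?U then ?U else comp_of V F x) ` V"
    unfolding components_eq comp_of_insert[OF assms] ..
  also have "\<dots> = (\<lambda>_. ?U) ` (V \<inter> ?U) \<union> comp_of V F ` (V - ?U)"
    by (auto simp: image_iff)
  also have "(\<lambda>_. ?U) ` (V \<inter> ?U) = {?U}"
    using assms(1) by (auto simp: in_comp_of intro!: image_eqI[of _ _ u])
  also have "comp_of V F ` (V - ?U) = components V F - {comp_of V F u, comp_of V F v}"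
    using out unfolding components_eq by blast
  finally show ?thesis by simp
qed

lemma components_insert_connected:
  assumes "u \<in> V" "v \<in> V" "u \<noteq> v" "(u, v) \<in> conn V F"
  shows "components V (insert {u, v} F) = components V F"
proof -
  have "comp_of V F u = comp_of V F v"
    using assms by (simp add: comp_of_eq_iff)
  then show ?thesis
    using assms unfolding components_insert[OF assms(1-3)] by (auto simp: components_eq)
qed

lemma union_comp_of_notin:
  assumes "(u, v) \<notin> conn V F"
  shows "comp_of V F u \<union> comp_of V F v \<notin> components V F"
proof
  assume *: "comp_of V F u \<union> comp_of V F v \<in> components V F"
  have "comp_of V F u = comp_of V F v"
    using comp_of_eq_component[OF *] by (metis UnI1 UnI2 conn_refl in_comp_of)
  then show False using assms by (simp add: comp_of_eq_iff)
qed

lemma card_components_insert: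
  assumes "finite V" "u \<in> V" "v \<in> V" "u \<noteq> v" "(u, v) \<notin> conn V F"
  shows "Suc (card (components V (insert {u, v} F))) = card (components V F)"
proof -
  have ne: "comp_of V F u \<noteq> comp_of V F v" using assms by (simp add: comp_of_eq_iff)
  have sub: "{comp_of V F u, comp_of V F v} \<subseteq> components V F"
    using assms by (auto simp: components_eq)
  have "card (components V F - {comp_of V F u, comp_of V F v}) = card (components V F) - 2"
    using card_Diff_subset[OF _ sub] ne by simp
  moreover have "card (components V F) \<ge> 2"
    using card_mono[OF finite_components[OF assms(1)] sub] ne by simp
  ultimately show ?thesis
    using union_comp_of_notin[OF assms(5)] finite_components[OF assms(1)]
    unfolding components_insert[OF assms(2-4)] by simp
qed

lemma card_components_insert_le:
  assumes "finite V" "u \<in> V" "v \<in> V" "u \<noteq> v"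
  shows "card (components V F) \<le> Suc (card (components V (insert {u, v} F)))"
  using card_components_insert[OF assms] components_insert_connected[OF assms(2-4)]
  by (cases "(u, v) \<in> conn V F") auto

section \<open>Forests by edge counting\<close>

lemma conn_empty: "conn V {} = Id"
  by (simp add: conn_def adj_rel_def)

lemma components_empty: "components V {} = (\<lambda>v. {v}) ` V"
  by (auto simp: components_eq comp_of_def conn_empty)

lemma forest_empty: "forest V {}"
  by (simp add: forest_def components_empty card_image)

text \<open>Starting from isolated vertices, each edge lowers the number of components by at most
  one; forests are the case of equality.\<close>

lemma card_le_edges_components:
  assumes "finite V" "F \<subseteq> edges_on V"
  shows "card V \<le> card F + card (components V F)"
proof -
  have "finite F" using assms finite_edges_on[of V] finite_subset[of F "edges_on V"] by simp
  then show ?thesis using assms(2)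
  proof (induction F rule: finite_induct)
    case empty
    then show ?case using forest_empty by (simp add: forest_def)
  next
    case (insert e F)
    then obtain u v where "e = {u, v}" "u \<in> V" "v \<in> V" "u \<noteq> v"
      by (auto simp: edges_on_def)
    then show ?case
      using insert card_components_insert_le[OF assms(1), of u v F] by simp
  qed
qed

lemma forest_finite: "finite V \<Longrightarrow> forest V F \<Longrightarrow> finite F"
  using finite_edges_on[of V] finite_subset[of F "edges_on V"] by (simp add: forest_def)

text \<open>An edge within a component raises the edge count without lowering the component count;
  by \<open>card_le_edges_components\<close> the larger set then misses equality.\<close>

lemma forest_insert_iff:
  assumes "finite V" "u \<in> V" "v \<in> V" "u \<noteq> v" "{u, v} \<notin> F"
  shows "forest V (insert {u, v} F) \<longleftrightarrow> forest V F \<and> (u, v) \<notin> conn V F"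
proof (cases "F \<subseteq> edges_on V")
  case True
  then have "finite F" using finite_edges_on[OF assms(1)] finite_subset by blast
  then show ?thesis
    using True assms(5) card_components_insert[OF assms(1-4), of F]
      components_insert_connected[OF assms(2-4), of F]
      card_le_edges_components[OF assms(1) True] edges_onI[OF assms(2-4)]
    by (cases "(u, v) \<in> conn V F") (simp_all add: forest_def, linarith)
qed (auto simp: forest_def)

text \<open>The edges of \<open>T - F\<close> are deleted one at a time, each deletion being
  \<open>forest_insert_iff\<close> read backwards.\<close>

lemma forest_subset:
  assumes "finite V" "forest V T" "F \<subseteq> T"
  shows "forest V F"
proof -
  have "finite T" using assms forest_finite by blast
  then have "finite (T - F)" by simp
  moreover have "D \<subseteq> T - F \<Longrightarrow> forest V (T - D)" if "finite D" for D
    using that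
  proof (induction D rule: finite_induct)
    case (insert e D)
    then have e: "e \<in> T" "e \<notin> D" by auto
    then obtain u v where uv: "e = {u, v}" "u \<in> V" "v \<in> V" "u \<noteq> v"
      using assms(2) by (auto simp: forest_def edges_on_def)
    have "T - D = insert {u, v} (T - insert e D)" using e uv by auto
    then show ?case
      using forest_insert_iff[OF assms(1) uv(2-4), of "T - insert e D"] insert uv by auto
  qed (use assms in auto)
  ultimately have "forest V (T - (T - F))" by blast
  then show ?thesis using assms(3) by (simp add: double_diff)
qed

lemma forest_edge_bridge:
  assumes "finite V" "forest V T" "{u, v} \<in> T" "F \<subseteq> T - {{u, v}}"
  shows "(u, v) \<notin> conn V F"
proof -
  have uv: "u \<in> V" "v \<in> V" "u \<noteq> v"
    using assms edges_onD unfolding forest_def by blast+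
  have "insert {u, v} F \<subseteq> T" "{u, v} \<notin> F" using assms(3,4) by blast+
  then show ?thesis
    using forest_insert_iff[OF assms(1) uv, of F] forest_subset[OF assms(1,2)] by simp
qed

section \<open>Agreement of the edge count with acyclicity\<close>

lemma conn_distinct_path:
  assumes "(u, v) \<in> conn V F" "u \<in> V"
  obtains vs where "vs \<noteq> []" "distinct vs" "set vs \<subseteq> V" "hd vs = u" "last vs = v"
    "\<And>i. i < length vs - 1 \<Longrightarrow> {vs ! i, vs ! Suc i} \<in> F"
proof -
  have "\<exists>vs. vs \<noteq> [] \<and> distinct vs \<and> set vs \<subseteq> V \<and> hd vs = u \<and> last vs = v \<and>
    (\<forall>i < length vs - 1. {vs ! i, vs ! Suc i} \<in> F)"
    using assms(1) unfolding conn_def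
  proof (induction rule: rtrancl_induct)
    case base
    then show ?case using assms(2) by (intro exI[of _ "[u]"]) auto
  next
    case (step y z)
    then obtain vs where vs: "vs \<noteq> []" "distinct vs" "set vs \<subseteq> V" "hd vs = u" "last vs = y"
      "\<forall>i < length vs - 1. {vs ! i, vs ! Suc i} \<in> F" by blast
    show ?case
    proof (cases "z \<in> set vs")
      case True
      then obtain j where j: "j < length vs" "vs ! j = z" by (auto simp: in_set_conv_nth)
      \<comment> \<open>The path already visits \<open>z\<close>, so it is cut off there instead of
        being extended.\<close>
      have "last (take (Suc j) vs) = z" using j by (simp add: take_Suc_conv_app_nth)
      moreover have "hd (take (Suc j) vs) = u" using vs by simp
      ultimately show ?thesis
        using vs j set_take_subset[of "Suc j" vs]
        by (intro exI[of _ "take (Suc j) vs"]) auto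
    next
      case False
      have "\<forall>i < length (vs @ [z]) - 1. {(vs @ [z]) ! i, (vs @ [z]) ! Suc i} \<in> F"
      proof (intro allI impI)
        fix i assume "i < length (vs @ [z]) - 1"
        then consider "i < length vs - 1" | "i = length vs - 1" by fastforce
        then show "{(vs @ [z]) ! i, (vs @ [z]) ! Suc i} \<in> F"
        proof cases
          case 2
          then show ?thesis using vs step(2)
            by (auto simp: nth_append last_conv_nth adj_rel_def)
        qed (use vs in \<open>auto simp: nth_append\<close>)
      qed
      then show ?thesis
        using vs step(2) False by (intro exI[of _ "vs @ [z]"]) (auto simp: adj_rel_def)
    qed
  qed
  then show ?thesis using that by blast
qed

lemma has_cycle_mono: "has_cycle V F \<Longrightarrow> F \<subseteq> F' \<Longrightarrow> has_cycle V F'"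
  unfolding has_cycle_def by blast

text \<open>The closing edge of a cycle joins two vertices that the other edges already connect, so
  it is not a bridge.\<close>

lemma forest_no_cycle:
  assumes "finite V" "forest V F"
  shows "\<not> has_cycle V F"
proof
  assume "has_cycle V F"
  then obtain vs where vs: "length vs \<ge> 3" "distinct vs" "set vs \<subseteq> V"
    "\<And>i. i < length vs - 1 \<Longrightarrow> {vs ! i, vs ! Suc i} \<in> F" "{last vs, hd vs} \<in> F"
    unfolding has_cycle_def by blast
  define e where "e = {last vs, hd vs}"
  have ne: "vs \<noteq> []" using vs by auto
  have ends: "hd vs = vs ! 0" "last vs = vs ! (length vs - 1)"
    using ne by (auto simp: hd_conv_nth last_conv_nth)
  \<comment> \<open>With at least three distinct vertices, no consecutive pair equals the closing
    edge.\<close>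
  have step: "{vs ! i, vs ! Suc i} \<in> F - {e}" if "i < length vs - 1" for i
  proof -
    have "i < length vs" "Suc i < length vs" "0 < length vs" "length vs - 1 < length vs"
      using that by auto
    then have "{vs ! i, vs ! Suc i} \<noteq> e"
      using that vs(1) nth_eq_iff_index_eq[OF vs(2)] unfolding e_def ends
      by (auto simp: doubleton_eq_iff)
    then show ?thesis using vs(4)[OF that] by blast
  qed
  have "(vs ! 0, vs ! i) \<in> conn V (F - {e})" if "i \<le> length vs - 1" for i
    using that
  proof (induction i)
    case (Suc i)
    have "(vs ! i, vs ! Suc i) \<in> conn V (F - {e})"
      using step[of i] Suc.prems assms(2) by (intro conn_edge) (auto simp: forest_def)
    then show ?case using Suc conn_trans[of "vs ! 0" "vs ! i" V "F - {e}" "vs ! Suc i"] by simp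
  qed simp
  then have "(hd vs, last vs) \<in> conn V (F - {e})" using ends by simp
  then show False
    using forest_edge_bridge[OF assms, of "hd vs" "last vs" "F - {e}"] vs(5)
    by (auto simp: e_def insert_commute)
qed

text \<open>If the next edge joined two connected vertices, a path between them closed by that edge
  would be a cycle.\<close>

lemma no_cycle_forest:
  assumes "finite V" "F \<subseteq> edges_on V" "\<not> has_cycle V F"
  shows "forest V F"
proof -
  have "finite F" using assms finite_edges_on[of V] finite_subset[of F "edges_on V"] by simp
  then show ?thesis using assms(2,3)
  proof (induction F rule: finite_induct)
    case empty
    show ?case by (rule forest_empty)
  next
    case (insert e F)
    then obtain u v where e: "e = {u, v}" and uv: "u \<in> V" "v \<in> V" "u \<noteq> v"
      by (auto simp: edges_on_def)
    have "forest V F" using insert has_cycle_mono[of V F "insert e F"] by auto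
    moreover have "(u, v) \<notin> conn V F"
    proof
      assume "(u, v) \<in> conn V F"
      then obtain vs where vs: "vs \<noteq> []" "distinct vs" "set vs \<subseteq> V" "hd vs = u" "last vs = v"
        "\<And>i. i < length vs - 1 \<Longrightarrow> {vs ! i, vs ! Suc i} \<in> F"
        using conn_distinct_path uv(1) by metis
      \<comment> \<open>Length one would force \<open>u = v\<close>, and length two would put the
        new edge into \<open>F\<close> already; hence there are three vertices, as
        \<open>has_cycle\<close> demands.\<close>
      have "length vs \<noteq> 1" using vs uv by (auto simp: length_Suc_conv)
      moreover have "length vs \<noteq> 2"
      proof
        assume "length vs = 2"
        then have "{u, v} \<in> F" using vs(6)[of 0] vs(1,4,5)
          by (auto simp: hd_conv_nth last_conv_nth)
        then show False using insert e by simp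
      qed
      moreover have "length vs \<noteq> 0" using vs by simp
      ultimately have "length vs \<ge> 3" by linarith
      then have "has_cycle V (insert e F)"
        unfolding has_cycle_def using vs e by (intro exI[of _ vs]) (auto simp: insert_commute)
      then show False using insert by simp
    qed
    ultimately show ?case using forest_insert_iff[OF assms(1) uv, of F] insert e by simp
  qed
qed

lemma is_tree_iff:
  assumes "finite V"
  shows "is_tree V T \<longleftrightarrow> forest V T \<and> (\<forall>u\<in>V. \<forall>v\<in>V. (u, v) \<in> conn V T)"
proof -
  have "(\<forall>e\<in>T. \<exists>u v. u \<in> V \<and> v \<in> V \<and> u \<noteq> v \<and> e = {u, v}) \<longleftrightarrow> T \<subseteq> edges_on V"
    by (auto simp: edges_on_def)
  then show ?thesis
    using forest_no_cycle[OF assms, of T] no_cycle_forest[OF assms, of T]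
    unfolding is_tree_def connected_graph_def conn_def by (auto simp: forest_def)
qed

section \<open>Counting forests that contain a given forest\<close>

text \<open>The number of ways to choose a root in each component.\<close>

definition comp_weight :: "nat set \<Rightarrow> nat set set \<Rightarrow> real" where
  "comp_weight V F = (\<Prod>C\<in>components V F. real (card C))"

text \<open>One count serves two purposes: a constant \<open>b\<close> yields spanning trees, and a
  labelling with \<open>k\<close> values yields forests that span \<open>k\<close> prescribed
  blocks.\<close>

definition block_forests :: "nat set \<Rightarrow> (nat \<Rightarrow> nat) \<Rightarrow> nat set set \<Rightarrow> nat set set set" where
  "block_forests V b F =
     {T. F \<subseteq> T \<and> forest V T \<and> (\<forall>u\<in>V. \<forall>v\<in>V. (u, v) \<in> conn V T \<longleftrightarrow> b u = b v)}"

text \<open>Merging parts of sizes \<open>x\<close> and \<open>y\<close> replaces the factor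
  \<open>x * y\<close> by \<open>x + y = x * y * (1/x + 1/y)\<close>.\<close>

lemma comp_weight_insert:
  assumes "finite V" "u \<in> V" "v \<in> V" "u \<noteq> v" "(u, v) \<notin> conn V F"
  shows "comp_weight V (insert {u, v} F) =
    comp_weight V F * (1 / real (card (comp_of V F u)) + 1 / real (card (comp_of V F v)))"
proof -
  let ?Cu = "comp_of V F u" and ?Cv = "comp_of V F v"
  let ?R = "components V F - {?Cu, ?Cv}"
  have fin: "finite (components V F)" "finite ?Cu" "finite ?Cv"
    using assms finite_components comp_of_subset finite_subset by metis+
  have in_comp: "?Cu \<in> components V F" "?Cv \<in> components V F"
    using assms by (auto simp: components_eq)
  have pos: "0 < card ?Cu" "0 < card ?Cv"
    using card_component_pos[OF assms(1)] in_comp by blast+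
  have disj: "?Cu \<inter> ?Cv = {}"
  proof (rule ccontr)
    assume "?Cu \<inter> ?Cv \<noteq> {}"
    then obtain x where "(u, x) \<in> conn V F" "(v, x) \<in> conn V F" by (auto simp: in_comp_of)
    then show False using assms(5) conn_trans[OF _ conn_sym] by blast
  qed
  have ne: "?Cu \<noteq> ?Cv"
    using assms(5) by (simp add: comp_of_eq_iff)
  have "comp_weight V F = (\<Prod>C\<in>?R. real (card C)) * (\<Prod>C\<in>{?Cu, ?Cv}. real (card C))"
    unfolding comp_weight_def using fin in_comp by (intro prod.subset_diff) auto
  also have "(\<Prod>C\<in>{?Cu, ?Cv}. real (card C)) = real (card ?Cu) * real (card ?Cv)"
    using ne by simp
  finally have 1: "comp_weight V F =
    (\<Prod>C\<in>?R. real (card C)) * (real (card ?Cu) * real (card ?Cv))" .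
  have "comp_weight V (insert {u, v} F) = real (card (?Cu \<union> ?Cv)) * (\<Prod>C\<in>?R. real (card C))"
    unfolding comp_weight_def components_insert[OF assms(2-4)]
    using fin union_comp_of_notin[OF assms(5)] by (subst prod.insert) auto
  also have "real (card (?Cu \<union> ?Cv)) = real (card ?Cu) + real (card ?Cv)"
    using fin disj by (simp add: card_Un_disjoint)
  finally show ?thesis
    unfolding 1 using pos by (simp add: field_simps)
qed

text \<open>The vertices of a component \<open>C\<close> contribute \<open>1 / card C\<close> each,
  hence 1 in total.\<close>

lemma sum_inverse_card_component:
  assumes "finite V"
  shows "(\<Sum>u\<in>V. 1 / real (card (comp_of V F u))) = real (card (components V F))"
proof -
  have "(\<Sum>u\<in>V. 1 / real (card (comp_of V F u)))
      = (\<Sum>C\<in>components V F. \<Sum>u\<in>C. 1 / real (card C))"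
    using sum_over_components[OF assms, of "\<lambda>C _. 1 / real (card C)"] .
  also have "\<dots> = (\<Sum>C\<in>components V F. 1)"
    using card_component_pos[OF assms] by (intro sum.cong) auto
  finally show ?thesis by simp
qed

lemma card_ordered_edges:
  assumes "finite D" "D \<subseteq> edges_on V"
  shows "card {(u, v). {u, v} \<in> D} = 2 * card D"
  using assms
proof (induction D rule: finite_induct)
  case (insert e D)
  then obtain x y where e: "e = {x, y}" "x \<noteq> y" by (auto simp: edges_on_def)
  have "{(u, v). {u, v} \<in> insert e D} = {(x, y), (y, x)} \<union> {(u, v). {u, v} \<in> D}"
    by (auto simp: e doubleton_eq_iff)
  moreover have "{(x, y), (y, x)} \<inter> {(u, v). {u, v} \<in> D} = {}"
    using insert(2) e by (auto simp: insert_commute)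
  moreover have "finite {(u, v). {u, v} \<in> D}"
  proof (rule finite_subset)
    show "{(u, v). {u, v} \<in> D} \<subseteq> \<Union>D \<times> \<Union>D" by auto
    have "finite e" if "e \<in> D" for e
      using that insert.prems by (auto simp: edges_on_def)
    then show "finite (\<Union>D \<times> \<Union>D)" using insert(1) by auto
  qed
  ultimately show ?case using insert e by (simp add: card_Un_disjoint)
qed simp

lemma finite_block_forests: "finite V \<Longrightarrow> finite (block_forests V b F)"
  by (rule finite_subset[of _ "Pow (edges_on V)"])
    (auto simp: block_forests_def forest_def finite_edges_on)

lemma forest_card_diff:
  assumes "finite V" "forest V T" "F \<subseteq> T"
  shows "card (T - F) + card (components V T) = card (components V F)"
proof -
  have "forest V F" "finite T"
    using assms forest_subset forest_finite by blast+
  moreover then have "card (T - F) + card F = card T"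
    using assms(3) card_Diff_subset[of F T] card_mono[of T F] finite_subset[of F T] by simp
  ultimately show ?thesis using assms(2) by (simp add: forest_def)
qed

section \<open>Spanning forests of \<open>k\<close> prescribed blocks of size
  \<open>n\<close>\<close>

context
  fixes V :: "nat set" and b :: "nat \<Rightarrow> nat" and n k :: nat
  assumes fin: "finite V" and n_pos: "0 < n" and card_V: "card V = k * n"
    and blocks: "\<And>u. u \<in> V \<Longrightarrow> card {v \<in> V. b u = b v} = n"
begin

lemma block_forest_components:
  assumes "T \<in> block_forests V b F"
  shows "C \<in> components V T \<Longrightarrow> card C = n" "card (components V T) = k"
proof -
  have comp: "card (comp_of V T u) = n" if "u \<in> V" for u
  proof -
    have "comp_of V T u = {v \<in> V. b u = b v}"
    proof (rule set_eqI)
      fix v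
      have "v \<in> V \<Longrightarrow> (u, v) \<in> conn V T \<longleftrightarrow> b u = b v"
        using assms that by (simp add: block_forests_def)
      then show "v \<in> comp_of V T u \<longleftrightarrow> v \<in> {v \<in> V. b u = b v}"
        using conn_in[OF _ that, of v T] unfolding in_comp_of by blast
    qed
    then show ?thesis using blocks that by simp
  qed
  then show "C \<in> components V T \<Longrightarrow> card C = n"
    by (auto simp: components_eq)
  show "card (components V T) = k"
    using card_components_uniform[OF fin comp] card_V n_pos by simp
qed

text \<open>Base case of the count: \<open>F\<close> and any \<open>T\<close> above it both have
  \<open>k\<close> components, so \<open>T - F\<close> is empty.\<close>

lemma block_forests_of_full:
  assumes "F \<in> block_forests V b F"
  shows "block_forests V b F = {F}"
proof -
  have "T = F" if "T \<in> block_forests V b F" for T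
  proof -
    have T: "forest V T" "F \<subseteq> T" using that by (auto simp: block_forests_def)
    have "card (T - F) = 0"
      using forest_card_diff[OF fin T] block_forest_components(2)[OF that]
        block_forest_components(2)[OF assms] by simp
    then show ?thesis using T forest_finite[OF fin T(1)] by auto
  qed
  then show ?thesis using assms by blast
qed

text \<open>A vertex in a component of size \<open>c\<close> has \<open>n - c\<close> partners in
  its block outside that component, which contribute \<open>n/c - 1\<close>; summing uses
  \<open>sum_inverse_card_component\<close> and \<open>card V = k * n\<close>.\<close>

lemma sum_cross_pairs:
  assumes "\<And>u v. {u, v} \<in> F \<Longrightarrow> b u = b v"
  defines "P \<equiv> {(u, v). u \<in> V \<and> v \<in> V \<and> b u = b v \<and> (u, v) \<notin> conn V F}"
  shows "(\<Sum>(u, v)\<in>P. 1 / real (card (comp_of V F u)))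
    = real n * (real (card (components V F)) - real k)"
proof -
  define Q where "Q u = {v \<in> V. b u = b v} - comp_of V F u" for u
  have pos: "0 < card (comp_of V F u)" if "u \<in> V" for u
    using card_component_pos[OF fin, of "comp_of V F u" F] that by (simp add: components_eq)
  have card_Q: "real (card (Q u)) = real n - real (card (comp_of V F u))" if "u \<in> V" for u
  proof -
    have sub: "comp_of V F u \<subseteq> {v \<in> V. b u = b v}"
      using comp_of_subset[OF that] conn_closed[of u _ V F b] assms(1)
      by (auto simp: in_comp_of)
    moreover have "card (comp_of V F u) \<le> n"
      using card_mono[OF _ sub] fin blocks[OF that] by simp
    ultimately show ?thesis
      unfolding Q_def using blocks[OF that] fin
      by (subst card_Diff_subset) (auto intro: finite_subset)
  qed
  have "P = Sigma V Q"
    by (auto simp: P_def Q_def in_comp_of)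
  then have "(\<Sum>(u, v)\<in>P. 1 / real (card (comp_of V F u)))
      = (\<Sum>u\<in>V. \<Sum>v\<in>Q u. 1 / real (card (comp_of V F u)))"
    using fin by (subst sum.Sigma) (auto simp: Q_def)
  also have "\<dots> = (\<Sum>u\<in>V. real n * (1 / real (card (comp_of V F u))) - 1)"
    using card_Q pos by (intro sum.cong) (auto simp: diff_divide_distrib)
  also have "\<dots> = real n * real (card (components V F)) - real (card V)"
    unfolding sum_subtractf sum_distrib_left[symmetric] sum_inverse_card_component[OF fin]
    by simp
  finally show ?thesis using card_V by (simp add: algebra_simps)
qed

text \<open>Double counting of ordered edges against the forests that contain them: each
  \<open>T\<close> has \<open>card (components V F) - k\<close> edges outside \<open>F\<close>, each
  with two orientations.\<close>

lemma sum_card_block_forests_insert: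
  assumes "forest V F"
  defines "P \<equiv> {(u, v). u \<in> V \<and> v \<in> V \<and> b u = b v \<and> (u, v) \<notin> conn V F}"
  shows "(\<Sum>(u, v)\<in>P. card (block_forests V b (insert {u, v} F)))
    = 2 * (card (components V F) - k) * card (block_forests V b F)"
proof -
  have "(\<Sum>(u, v)\<in>P. card (block_forests V b (insert {u, v} F)))
      = (\<Sum>p\<in>P. card {T \<in> block_forests V b F. {fst p, snd p} \<in> T})"
    by (intro sum.cong refl) (auto simp: block_forests_def intro!: arg_cong[of _ _ card])
  also have "\<dots> = 2 * (card (components V F) - k) * card (block_forests V b F)"
  proof (rule sum_multicount[OF _ finite_block_forests[OF fin]])
    show "finite P"
      by (rule finite_subset[of _ "V \<times> V"]) (auto simp: P_def fin)
    show "\<forall>T\<in>block_forests V b F. card {p \<in> P. {fst p, snd p} \<in> T}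
        = 2 * (card (components V F) - k)"
    proof
      fix T assume T: "T \<in> block_forests V b F"
      then have T': "forest V T" "F \<subseteq> T" "T \<subseteq> edges_on V"
        and bT: "\<And>u v. u \<in> V \<Longrightarrow> v \<in> V \<Longrightarrow> (u, v) \<in> conn V T \<longleftrightarrow> b u = b v"
        by (auto simp: block_forests_def forest_def)
      have "{p \<in> P. {fst p, snd p} \<in> T} = {(u, v). {u, v} \<in> T - F}"
      proof (intro set_eqI iffI)
        fix p assume "p \<in> {p \<in> P. {fst p, snd p} \<in> T}"
        then show "p \<in> {(u, v). {u, v} \<in> T - F}"
          using conn_edge[of "fst p" "snd p" F V] assms(1) by (auto simp: P_def forest_def)
      next
        fix p assume "p \<in> {(u, v). {u, v} \<in> T - F}"
        then obtain u v where p: "p = (u, v)" and uv: "{u, v} \<in> T" "{u, v} \<notin> F" by blast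
        have "u \<in> V" "v \<in> V" using uv(1) T'(3) edges_onD by blast+
        moreover have "b u = b v" using conn_edge[OF uv(1) T'(3)] bT calculation by blast
        moreover have "(u, v) \<notin> conn V F"
          using forest_edge_bridge[OF fin T'(1) uv(1), of F] uv(2) T'(2) by blast
        ultimately show "p \<in> {p \<in> P. {fst p, snd p} \<in> T}" using p uv by (simp add: P_def)
      qed
      also have "card \<dots> = 2 * card (T - F)"
        using T' forest_finite[OF fin T'(1)] by (intro card_ordered_edges[of _ V]) auto
      also have "card (T - F) = card (components V F) - k"
        using forest_card_diff[OF fin T'(1,2)] block_forest_components(2)[OF T] by simp
      finally show "card {p \<in> P. {fst p, snd p} \<in> T} = 2 * (card (components V F) - k)" .
    qed
  qed
  finally show ?thesis .
qed

text \<open>Double counting of the edges of \<open>T - F\<close> over all admissible \<open>T \<supseteq> F\<close>: joining components of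
  sizes \<open>x\<close> and \<open>y\<close> multiplies the weight by \<open>1/x + 1/y\<close>, and these factors sum to a
  quantity that depends only on the number of components.\<close>
theorem card_block_forests:
  assumes "forest V F" "\<And>u v. {u, v} \<in> F \<Longrightarrow> b u = b v"
  shows "real (card (block_forests V b F)) * real n ^ (2 * k)
    = real n ^ card (components V F) * comp_weight V F"
  using assms
proof (induction "card (components V F)" arbitrary: F rule: less_induct)
  case less
  define P where "P = {(u, v). u \<in> V \<and> v \<in> V \<and> b u = b v \<and> (u, v) \<notin> conn V F}"
  define m where "m = card (components V F)"
  define c where "c u = real (card (comp_of V F u))" for u
  have finP: "finite P"
    by (rule finite_subset[of _ "V \<times> V"]) (auto simp: P_def fin)
  have c_pos: "0 < c u" if "u \<in> V" for u
    using card_component_pos[OF fin, of "comp_of V F u" F] that by (simp add: components_eq c_def)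
  show ?case
  proof (cases "P = {}")
    \<comment> \<open>No two vertices of a block remain disconnected, so \<open>F\<close> itself is
      the only forest counted.\<close>
    case True
    have "(u, v) \<in> conn V F \<longleftrightarrow> b u = b v" if "u \<in> V" "v \<in> V" for u v
      using True that conn_closed[of u v V F b] less.prems(2) by (auto simp: P_def)
    then have F: "F \<in> block_forests V b F"
      using less.prems(1) by (auto simp: block_forests_def)
    have "comp_weight V F = real n ^ k"
      unfolding comp_weight_def using block_forest_components[OF F] by simp
    then show ?thesis
      using block_forests_of_full[OF F] block_forest_components(2)[OF F]
      by (simp add: mult_2 power_add)
  next
    case False
    have S: "(\<Sum>(u, v)\<in>P. 1 / c u) = real n * (real m - real k)"
      unfolding P_def m_def c_def by (rule sum_cross_pairs[OF less.prems(2)])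
    have "0 < (\<Sum>(u, v)\<in>P. 1 / c u)"
      using finP False c_pos by (intro sum_pos) (auto simp: P_def)
    then have km: "k < m" using S n_pos by (simp add: zero_less_mult_iff)
    \<comment> \<open>The set of pairs is symmetric, so both endpoints contribute the same
      sum.\<close>
    have bij: "bij_betw prod.swap P P"
      by (rule bij_betwI[of _ _ _ prod.swap]) (auto simp: P_def dest: conn_sym)
    have S': "(\<Sum>(u, v)\<in>P. 1 / c v) = real n * (real m - real k)"
      using sum.reindex_bij_betw[OF bij, of "\<lambda>(u, v). 1 / c u"] S
      by (simp add: case_prod_unfold)
    have step: "real (card (block_forests V b (insert {u, v} F))) * real n ^ (2 * k)
        = real n ^ (m - 1) * comp_weight V F * (1 / c u + 1 / c v)" if "(u, v) \<in> P" for u v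
    proof -
      have uv: "u \<in> V" "v \<in> V" "b u = b v" "(u, v) \<notin> conn V F" "u \<noteq> v"
        using that by (auto simp: P_def)
      have e: "{u, v} \<notin> F"
        using conn_edge[of u v F V] less.prems(1) uv(4) by (auto simp: forest_def)
      have card: "Suc (card (components V (insert {u, v} F))) = m"
        unfolding m_def using card_components_insert[OF fin] uv by simp
      have "forest V (insert {u, v} F)"
        using forest_insert_iff[OF fin uv(1,2,5) e] less.prems(1) uv(4) by simp
      moreover have "b x = b y" if "{x, y} \<in> insert {u, v} F" for x y
        using that less.prems(2) uv(3) by (auto simp: doubleton_eq_iff)
      ultimately have "real (card (block_forests V b (insert {u, v} F))) * real n ^ (2 * k)
        = real n ^ card (components V (insert {u, v} F)) * comp_weight V (insert {u, v} F)"
        using card unfolding m_def by (intro less.hyps) auto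
      moreover have "card (components V (insert {u, v} F)) = m - 1" using card by simp
      ultimately show ?thesis
        using comp_weight_insert[OF fin uv(1,2,5,4)] by (simp add: c_def)
    qed
    \<comment> \<open>The recurrence carries the factor \<open>2 * (m - k)\<close> on both sides; it
      is positive and cancels at the end.\<close>
    have "2 * (real m - real k) * (real (card (block_forests V b F)) * real n ^ (2 * k))
        = real (2 * (m - k) * card (block_forests V b F)) * real n ^ (2 * k)"
      using km by (simp add: of_nat_diff)
    also have "\<dots> = real (\<Sum>(u, v)\<in>P. card (block_forests V b (insert {u, v} F))) * real n ^ (2 * k)"
      unfolding P_def m_def sum_card_block_forests_insert[OF less.prems(1)] ..
    also have "\<dots> = (\<Sum>(u, v)\<in>P.
        real (card (block_forests V b (insert {u, v} F))) * real n ^ (2 * k))"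
      by (simp add: sum_distrib_right case_prod_unfold)
    also have "\<dots> = (\<Sum>(u, v)\<in>P. real n ^ (m - 1) * comp_weight V F * (1 / c u + 1 / c v))"
      using step by (intro sum.cong) auto
    also have "\<dots> = real n ^ (m - 1) * comp_weight V F *
        ((\<Sum>(u, v)\<in>P. 1 / c u) + (\<Sum>(u, v)\<in>P. 1 / c v))"
      by (simp add: sum_distrib_left case_prod_unfold sum.distrib[symmetric])
    also have "\<dots> = 2 * (real m - real k) * (real n ^ (m - 1) * real n * comp_weight V F)"
      unfolding S S' by (simp add: algebra_simps)
    also have "real n ^ (m - 1) * real n = real n ^ m"
      using km by (cases m) auto
    finally show ?thesis using km by (simp add: m_def)
  qed
qed

end

text \<open>The case of a single block. The factor \<open>card V ^ 2\<close> stays on the left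
  because the exponent \<open>m - 2\<close> for \<open>m\<close> components would be truncated when
  \<open>m = 1\<close>.\<close>

lemma card_trees_containing:
  assumes "finite V" "V \<noteq> {}" "forest V F"
  shows "real (card {T. F \<subseteq> T \<and> is_tree V T}) * real (card V) ^ 2
    = real (card V) ^ card (components V F) * comp_weight V F"
proof -
  have "{T. F \<subseteq> T \<and> is_tree V T} = block_forests V (\<lambda>_. 0) F"
    by (auto simp: is_tree_iff[OF assms(1)] block_forests_def)
  then show ?thesis
    using card_block_forests[of V "card V" 1 "\<lambda>_. 0" F] assms by (simp add: card_gt_0_iff)
qed

lemma comp_weight_le:
  assumes "finite V" "forest V F"
  shows "comp_weight V F \<le> 2 ^ card F"
proof -
  have "comp_weight V F \<le> (\<Prod>C\<in>components V F. 2 ^ (card C - 1))"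
    unfolding comp_weight_def
  proof (intro prod_mono conjI)
    fix C assume "C \<in> components V F"
    then have "0 < card C" by (rule card_component_pos[OF assms(1)])
    then have "card C \<le> 2 ^ (card C - 1)"
      using less_exp[of "card C - 1"] by linarith
    then show "real (card C) \<le> 2 ^ (card C - 1)"
      by (metis of_nat_le_iff of_nat_numeral of_nat_power)
  qed auto
  also have "\<dots> = 2 ^ (\<Sum>C\<in>components V F. card C - 1)"
    by (rule power_sum[symmetric])
  \<comment> \<open>The sizes reduced by one add up to the number of edges, by Euler's
    count.\<close>
  also have "(\<Sum>C\<in>components V F. card C - 1) = card V - card (components V F)"
    using card_component_pos[OF assms(1)] sum_card_components[OF assms(1), of F]
    by (subst sum_subtractf_nat) (auto simp: Suc_leI)
  also have "\<dots> = card F" using assms(2) unfolding forest_def by linarith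
  finally show ?thesis .
qed

text \<open>The leading quotient is Cayley's number of trees; each prescribed edge brings a further
  factor \<open>2 / card V\<close>.\<close>

lemma card_trees_containing_le:
  assumes "finite V" "V \<noteq> {}" "forest V F"
  shows "real (card {T. F \<subseteq> T \<and> is_tree V T})
    \<le> real (card V) ^ card V / real (card V) ^ 2 * (2 / real (card V)) ^ card F"
proof -
  have pos: "0 < real (card V)" using assms by (simp add: card_gt_0_iff)
  have "real (card {T. F \<subseteq> T \<and> is_tree V T}) * real (card V) ^ 2 * real (card V) ^ card F
      = real (card V) ^ card V * comp_weight V F"
    using card_trees_containing[OF assms] assms(3)
    by (simp add: forest_def power_add[symmetric] ac_simps)
  also have "\<dots> \<le> real (card V) ^ card V * 2 ^ card F"
    using comp_weight_le[OF assms(1,3)] by (intro mult_left_mono) auto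
  finally show ?thesis using pos by (simp add: field_simps)
qed

section \<open>Splittable trees of the complete graph\<close>

lemma card_eq_sum_components:
  assumes "finite V" "X \<subseteq> V"
  shows "card X = (\<Sum>C\<in>components V F. card (C \<inter> X))"
proof -
  have "card X = (\<Sum>u\<in>V. if u \<in> X then 1 else 0)"
    using assms by (simp add: sum.If_cases Int_absorb1)
  also have "\<dots> = (\<Sum>C\<in>components V F. \<Sum>u\<in>C. if u \<in> X then 1 else 0)"
    using sum_over_components[OF assms(1), of "\<lambda>_ u. if u \<in> X then 1 else 0"] .
  also have "\<dots> = (\<Sum>C\<in>components V F. card (C \<inter> X))"
  proof (intro sum.cong refl)
    fix C assume "C \<in> components V F"
    then have "finite C" using component_subset assms(1) finite_subset by metis
    then show "(\<Sum>u\<in>C. if u \<in> X then 1 else 0) = card (C \<inter> X)"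
      by (simp add: sum.If_cases)
  qed
  finally show ?thesis .
qed

text \<open>Removing an edge \<open>e\<close> from \<open>T\<close> cuts off a set \<open>X\<close> of vertices.  If \<open>e \<notin> F2\<close> then
  \<open>X\<close> is a union of components of \<open>F2\<close>, so its size is a multiple of \<open>n\<close>; if
  \<open>e \<in> F1\<close> then \<open>X\<close> consists of components of \<open>F1\<close> and a proper part of a further one.\<close>
lemma equal_split_subset:
  assumes "finite V" "forest V T" "F1 \<subseteq> T" "F2 \<subseteq> T"
    and F1: "\<And>C. C \<in> components V F1 \<Longrightarrow> card C = n"
    and F2: "\<And>C. C \<in> components V F2 \<Longrightarrow> card C = n"
  shows "F1 \<subseteq> F2"
proof
  fix e assume e1: "e \<in> F1"
  show "e \<in> F2"
  proof (rule ccontr)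
    assume e2: "e \<notin> F2"
    obtain x y where e: "e = {x, y}" and xy: "x \<in> V" "y \<in> V" "x \<noteq> y"
      using e1 assms(2,3) by (auto simp: forest_def edges_on_def)
    define X where "X = comp_of V (T - {e}) x"
    have XV: "X \<subseteq> V" unfolding X_def by (rule comp_of_subset[OF xy(1)])
    have y: "y \<notin> X"
      using forest_edge_bridge[OF assms(1,2), of x y "T - {e}"] e e1 assms(3)
      by (auto simp: X_def in_comp_of)
    have X_closed: "w \<in> X" if "u \<in> X" "(u, w) \<in> conn V F" "F \<subseteq> T - {e}" for u w F
      using that conn_mono[OF that(3), of V] conn_trans[of x u V "T - {e}" w]
      unfolding X_def in_comp_of by blast
    have dvd: "n dvd card (C \<inter> X)"
      if "card C = n" "\<And>u w. u \<in> C \<Longrightarrow> w \<in> C \<Longrightarrow> u \<in> X \<Longrightarrow> w \<in> X" for C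
    proof (cases "C \<inter> X = {}")
      case False
      then have "C \<inter> X = C" using that(2) by blast
      then show ?thesis using that(1) by simp
    qed simp
    have same: "(u, w) \<in> conn V F" if "C \<in> components V F" "u \<in> C" "w \<in> C" for C u w F
      using that comp_of_eq_component[OF that(1)] comp_of_eq_iff by metis
    have "n dvd card (C \<inter> X)" if C: "C \<in> components V F2" for C
      using X_closed[of _ _ F2] same[OF C] e2 assms(4) F2[OF C] by (intro dvd) blast+
    then have X2: "n dvd card X"
      unfolding card_eq_sum_components[OF assms(1) XV, of F2] by (intro dvd_sum)
    define B where "B = comp_of V F1 x"
    have B: "B \<in> components V F1" using xy(1) by (simp add: B_def components_eq)
    have xyB: "x \<in> B" "y \<in> B"
      using conn_edge[of x y F1 V] e e1 assms(2,3) by (auto simp: B_def in_comp_of forest_def)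
    have "n dvd card (C \<inter> X)" if C: "C \<in> components V F1" "C \<noteq> B" for C
    proof (rule dvd)
      show "card C = n" using F1 C by simp
      fix u w assume uw: "u \<in> C" "w \<in> C" "u \<in> X"
      \<comment> \<open>A walk in \<open>F1\<close> from \<open>u\<close> to \<open>w\<close> could
        need \<open>e\<close> only if \<open>u\<close> were connected to an end of \<open>e\<close>;
        both ends lie in \<open>B\<close>, a different component.\<close>
      have "insert {x, y} (F1 - {e}) = F1" using e e1 by auto
      then have "(u, w) \<in> conn V (F1 - {e}) \<or> (u, x) \<in> conn V F1 \<or> (u, y) \<in> conn V F1"
        using same[OF C(1) uw(1,2)] conn_insert[OF xy, of u w "F1 - {e}"]
          conn_mono[of "F1 - {e}" F1 V] by auto
      moreover have "(u, z) \<notin> conn V F1" if "z \<in> B" for z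
        using comp_of_eq_component[OF C(1) uw(1)] comp_of_eq_component[OF B that] C(2)
          comp_of_eq_iff by metis
      ultimately have "(u, w) \<in> conn V (F1 - {e})" using xyB by blast
      then show "w \<in> X" using X_closed[OF uw(3)] assms(3) by blast
    qed
    then have "n dvd (\<Sum>C\<in>components V F1 - {B}. card (C \<inter> X))"
      by (intro dvd_sum) auto
    moreover have "card X = card (B \<inter> X) + (\<Sum>C\<in>components V F1 - {B}. card (C \<inter> X))"
      unfolding card_eq_sum_components[OF assms(1) XV, of F1]
      using B finite_components[OF assms(1)] by (rule sum.remove[rotated])
    ultimately have "n dvd card (B \<inter> X)"
      using X2 by (simp add: dvd_add_left_iff)
    moreover have fB: "finite B" using component_subset[OF B] assms(1) finite_subset by blast
    moreover have "x \<in> B \<inter> X" using xyB by (simp add: X_def in_comp_of)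
    moreover have "card (B \<inter> X) < card B"
      using y xyB by (intro psubset_card_mono fB) blast
    ultimately show False
      using F1[OF B] by (metis card_gt_0_iff dvd_imp_le empty_iff finite_Int not_less)
  qed
qed

definition equal_forests :: "nat set \<Rightarrow> nat \<Rightarrow> nat set set set" where
  "equal_forests V n = {F. forest V F \<and> (\<forall>C\<in>components V F. card C = n)}"

lemma finite_equal_forests: "finite V \<Longrightarrow> finite (equal_forests V n)"
  by (rule finite_subset[of _ "Pow (edges_on V)"])
    (auto simp: equal_forests_def forest_def finite_edges_on)

lemma card_components_equal_forest:
  assumes "finite V" "card V = k * n" "0 < n" "F \<in> equal_forests V n"
  shows "card (components V F) = k"
  using card_components_uniform[OF assms(1), of F n] assms(2-4)
  by (auto simp: equal_forests_def components_eq)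

lemma card_components_tree:
  assumes "finite V" "V \<noteq> {}" "is_tree V T"
  shows "card (components V T) = 1"
proof -
  have "comp_of V T u = V" if "u \<in> V" for u
    using assms(3) comp_of_subset[OF that, of T] that is_tree_iff[OF assms(1)]
    by (auto simp: in_comp_of)
  then have "components V T = {V}"
    using assms(2) by (auto simp: components_eq)
  then show ?thesis by simp
qed

lemma tree_subset_edges: "is_tree V T \<Longrightarrow> T \<subseteq> edges_on V"
  by (auto simp: is_tree_def edges_on_def)

lemma finite_trees: "finite V \<Longrightarrow> finite {T. is_tree V T}"
  by (rule finite_subset[of _ "Pow (edges_on V)"])
    (auto simp: finite_edges_on dest: tree_subset_edges)

text \<open>The deleted edges are \<open>T - F\<close>; there are \<open>k - 1\<close> of them
  because \<open>T\<close> has one component and \<open>F\<close> has \<open>k\<close>.\<close>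

lemma k_splittable_if_equal_forest:
  assumes "finite V" "card V = k * n" "0 < n" "0 < k" "F \<in> equal_forests V n" "F \<subseteq> T" "is_tree V T"
  shows "k_splittable k V T"
proof -
  have "V \<noteq> {}" using assms by auto
  then have "card (T - F) + 1 = card (components V F)"
    using forest_card_diff[OF assms(1) _ assms(6)] assms(7)
      card_components_tree[OF assms(1) _ assms(7)] is_tree_iff[OF assms(1)] by metis
  moreover have "T - (T - F) = F" using assms(6) by auto
  ultimately show ?thesis
    using assms(5) card_components_equal_forest[OF assms(1-3,5)] unfolding k_splittable_def
    by (intro exI[of _ "T - F"]) (auto simp: equal_forests_def)
qed

text \<open>Each equal forest extends to \<open>N ^ k * n ^ k / N ^ 2\<close> trees, all
  \<open>k\<close>-splittable. By \<open>equal_split_subset\<close> no tree extends two different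
  equal forests, so these counts add up.\<close>

lemma tau_k_complete_ge:
  assumes "0 < n" "0 < k"
  defines "N \<equiv> k * n"
  shows "real (card (equal_forests {0..<N} n)) * (real N ^ k * real n ^ k / real N ^ 2)
    \<le> real (tau_k k N (all_edges N))"
proof -
  let ?V = "{0..<N}"
  define A where "A F = {T. F \<subseteq> T \<and> is_tree ?V T}" for F
  have N: "0 < N" "card ?V = k * n" "?V \<noteq> {}" using assms by auto
  have finA: "finite (A F)" for F
    unfolding A_def using finite_trees[of ?V] by (rule finite_subset[rotated]) auto
  have card_A: "real (card (A F)) = real N ^ k * real n ^ k / real N ^ 2"
    if "F \<in> equal_forests ?V n" for F
  proof -
    have F: "forest ?V F" "\<And>C. C \<in> components ?V F \<Longrightarrow> card C = n"
      using that by (auto simp: equal_forests_def)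
    have "card (components ?V F) = k"
      using card_components_equal_forest[of ?V k n F] N(2) assms(1) that by simp
    then show ?thesis
      using card_trees_containing[OF _ N(3) F(1)] N(1) F(2) unfolding A_def comp_weight_def
      by (simp add: field_simps)
  qed
  have disj: "A F1 \<inter> A F2 = {}"
    if "F1 \<in> equal_forests ?V n" "F2 \<in> equal_forests ?V n" "F1 \<noteq> F2" for F1 F2
  proof (rule ccontr)
    assume "A F1 \<inter> A F2 \<noteq> {}"
    then obtain T where "F1 \<subseteq> T" "F2 \<subseteq> T" "forest ?V T"
      using is_tree_iff[of ?V] by (auto simp: A_def)
    then have "F1 \<subseteq> F2" "F2 \<subseteq> F1"
      using that equal_split_subset[of ?V T _ _ n] by (simp_all add: equal_forests_def)
    then show False using that(3) by blast
  qed
  have "real (card (equal_forests ?V n)) * (real N ^ k * real n ^ k / real N ^ 2)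
      = (\<Sum>F\<in>equal_forests ?V n. real (card (A F)))"
    using card_A by simp
  also have "\<dots> = real (card (\<Union>F\<in>equal_forests ?V n. A F))"
    using finA disj finite_equal_forests[of ?V n] by (subst card_UN_disjoint) auto
  also have "\<dots> \<le> real (tau_k k N (all_edges N))"
    unfolding tau_k_def of_nat_le_iff
  proof (rule card_mono)
    show "finite {T \<in> spanning_trees N (all_edges N). k_splittable k ?V T}"
      by (rule finite_subset[OF _ finite_trees[of ?V]]) (auto simp: spanning_trees_def)
    show "(\<Union>F\<in>equal_forests ?V n. A F)
        \<subseteq> {T \<in> spanning_trees N (all_edges N). k_splittable k ?V T}"
      using k_splittable_if_equal_forest[of ?V k n] N(2) assms(1,2) tree_subset_edges
      by (auto simp: A_def spanning_trees_def all_edges_eq subset_iff)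
  qed
  finally show ?thesis .
qed

section \<open>Counting equal forests through balanced labellings\<close>

definition equal_blocks :: "nat \<Rightarrow> nat \<Rightarrow> nat multiset" where
  "equal_blocks k n = (\<Sum>i<k. replicate_mset n i)"

lemma count_equal_blocks: "count (equal_blocks k n) i = (if i < k then n else 0)"
  by (simp add: equal_blocks_def count_sum)

lemma set_equal_blocks: "0 < n \<Longrightarrow> set_mset (equal_blocks k n) = {..<k}"
  by (auto simp: set_mset_def count_equal_blocks)

lemma size_equal_blocks: "size (equal_blocks k n) = k * n"
  by (simp add: equal_blocks_def size_multiset_sum)

lemma card_permutations_equal_blocks:
  assumes "0 < n"
  shows "card (permutations_of_multiset (equal_blocks k n)) * fact n ^ k = fact (k * n)"
proof -
  have "(\<Prod>x\<in>set_mset (equal_blocks k n). fact (count (equal_blocks k n) x)) = (fact n ^ k :: nat)"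
    by (simp add: set_equal_blocks[OF assms] count_equal_blocks)
  then show ?thesis
    using card_permutations_of_multiset[of "equal_blocks k n"] by (simp add: size_equal_blocks)
qed

text \<open>A permutation \<open>xs\<close> of \<open>equal_blocks k n\<close> labels vertex
  \<open>v\<close> by \<open>xs ! v\<close> and uses each label \<open>n\<close> times. By
  \<open>card_block_forests\<close> each labelling carries \<open>n ^ N / n ^ (2 * k)\<close>
  forests. An equal forest arises from at most \<open>k ^ k\<close> labellings, since the labels of
  its \<open>k\<close> components determine the labelling.\<close>

lemma card_equal_forests_ge:
  assumes "0 < n" "0 < k"
  defines "N \<equiv> k * n"
  shows "real (card (permutations_of_multiset (equal_blocks k n))) * real n ^ N
    \<le> real (card (equal_forests {0..<N} n)) * real k ^ k * real n ^ (2 * k)"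
proof -
  let ?V = "{0..<N}"
  let ?M = "permutations_of_multiset (equal_blocks k n)"
  let ?L = "\<lambda>F. components ?V F \<rightarrow>\<^sub>E {..<k}"
  have len: "length xs = N" if "xs \<in> ?M" for xs
    using that size_mset[of xs] by (simp add: permutations_of_multiset_def size_equal_blocks N_def)
  have lt: "xs ! v < k" if "xs \<in> ?M" "v < N" for xs v
    using that len[OF that(1)] set_equal_blocks[OF assms(1), of k] nth_mem[of v xs]
    by (metis lessThan_iff permutations_of_multisetD set_mset_mset)
  have blocks: "card {v \<in> ?V. xs ! u = xs ! v} = n" if "xs \<in> ?M" "u \<in> ?V" for xs u
  proof -
    have "{v \<in> ?V. xs ! u = xs ! v} = {v. v < length xs \<and> xs ! u = xs ! v}"
      using len[OF that(1)] by auto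
    also have "card \<dots> = count (mset xs) (xs ! u)"
      by (simp add: length_filter_conv_card[symmetric] count_mset count_list_eq_length_filter)
    also have "\<dots> = n"
      using that lt[OF that(1), of u] count_equal_blocks[of k n "xs ! u"]
      by (simp add: permutations_of_multiset_def)
    finally show ?thesis .
  qed
  have card_V: "card ?V = k * n" by (simp add: N_def)
  have count: "real (card (block_forests ?V ((!) xs) {})) * real n ^ (2 * k) = real n ^ N"
    if "xs \<in> ?M" for xs
  proof -
    have "comp_weight ?V {} = 1"
      unfolding comp_weight_def components_empty by (intro prod.neutral) auto
    moreover have "card (components ?V {}) = N"
      by (simp add: components_empty card_image)
    ultimately show ?thesis
      using card_block_forests[OF finite_atLeastLessThan assms(1) card_V blocks[OF that]
          forest_empty] by simp
  qed
  have equal: "F \<in> equal_forests ?V n" if "xs \<in> ?M" "F \<in> block_forests ?V ((!) xs) {}" for xs F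
    using block_forest_components(1)[OF finite_atLeastLessThan assms(1) card_V blocks[OF that(1)]
        that(2)] that(2) by (auto simp: equal_forests_def block_forests_def)
  \<comment> \<open>The label of a component is read off at an arbitrary vertex;
    \<open>lab_nth\<close> shows that the choice does not matter. \<open>restrict\<close> makes the
    function extensional, so that it lies in a finite function space.\<close>
  define lab where "lab = (\<lambda>(xs :: nat list, F).
    (F, restrict (\<lambda>C. xs ! (SOME v. v \<in> C)) (components ?V F)))"
  have lab_nth: "snd (lab (xs, F)) (comp_of ?V F v) = xs ! v"
    if "F \<in> block_forests ?V ((!) xs) {}" "v \<in> ?V" for xs F v
  proof -
    have C: "comp_of ?V F v \<in> components ?V F" using that(2) by (simp add: components_eq)
    have some: "(v, SOME w. w \<in> comp_of ?V F v) \<in> conn ?V F"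
      using someI[of "\<lambda>w. w \<in> comp_of ?V F v" v] by (simp add: in_comp_of)
    then have "xs ! v = xs ! (SOME w. w \<in> comp_of ?V F v)"
      using that conn_in[OF some that(2)] unfolding block_forests_def by blast
    then show ?thesis using C by (simp add: lab_def)
  qed
  have "card (Sigma ?M (\<lambda>xs. block_forests ?V ((!) xs) {}))
      \<le> card (Sigma (equal_forests ?V n) ?L)"
  proof (rule card_inj_on_le)
    show "inj_on lab (Sigma ?M (\<lambda>xs. block_forests ?V ((!) xs) {}))"
    proof (rule inj_onI)
      fix p q assume pq: "p \<in> Sigma ?M (\<lambda>xs. block_forests ?V ((!) xs) {})"
        "q \<in> Sigma ?M (\<lambda>xs. block_forests ?V ((!) xs) {})" "lab p = lab q"
      obtain xs F ys F' where [simp]: "p = (xs, F)" "q = (ys, F')" by fastforce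
      have F': "F' = F" using pq(3) by (simp add: lab_def)
      have "xs ! v = ys ! v" if "v < N" for v
        using lab_nth[of F xs v] lab_nth[of F ys v] pq that F' by simp
      then have "xs = ys" using pq len by (intro nth_equalityI) auto
      then show "p = q" using F' by simp
    qed
    show "lab ` Sigma ?M (\<lambda>xs. block_forests ?V ((!) xs) {}) \<subseteq> Sigma (equal_forests ?V n) ?L"
    proof
      fix z assume "z \<in> lab ` Sigma ?M (\<lambda>xs. block_forests ?V ((!) xs) {})"
      then obtain xs F where z: "z = lab (xs, F)" and xs: "xs \<in> ?M"
        and F: "F \<in> block_forests ?V ((!) xs) {}" by auto
      have "xs ! (SOME v. v \<in> C) < k" if C: "C \<in> components ?V F" for C
      proof -
        have "(SOME v. v \<in> C) \<in> C" using component_nonempty[OF C] some_in_eq by blast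
        then have "(SOME v. v \<in> C) < N" using component_subset[OF C] by auto
        then show ?thesis using lt[OF xs] by simp
      qed
      then show "z \<in> Sigma (equal_forests ?V n) ?L"
        using equal[OF xs F] by (auto simp: z lab_def)
    qed
    show "finite (Sigma (equal_forests ?V n) ?L)"
      by (intro finite_SigmaI finite_equal_forests finite_PiE finite_components) auto
  qed
  also have "\<dots> = card (equal_forests ?V n) * k ^ k"
  proof -
    have "card (?L F) = k ^ k" if "F \<in> equal_forests ?V n" for F
      using card_components_equal_forest[OF _ card_V assms(1) that] finite_components[of ?V F]
      by (simp add: card_funcsetE)
    then show ?thesis
      by (subst card_SigmaI)
        (auto intro!: finite_equal_forests finite_PiE finite_components)
  qed
  finally have le: "card (Sigma ?M (\<lambda>xs. block_forests ?V ((!) xs) {}))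
    \<le> card (equal_forests ?V n) * k ^ k" .
  have "real (card ?M) * real n ^ N
      = (\<Sum>xs\<in>?M. real (card (block_forests ?V ((!) xs) {})) * real n ^ (2 * k))"
    using count by simp
  also have "\<dots> = real (card (Sigma ?M (\<lambda>xs. block_forests ?V ((!) xs) {}))) * real n ^ (2 * k)"
    by (subst card_SigmaI) (auto simp: sum_distrib_right intro: finite_block_forests)
  also have "\<dots> \<le> real (card (equal_forests ?V n) * k ^ k) * real n ^ (2 * k)"
    using le by (intro mult_right_mono) (auto simp del: of_nat_mult)
  finally show ?thesis by simp
qed

section \<open>A lower bound for the multinomial coefficient\<close>

lemma fact_add_eq_prod: "fact (m + j) = fact m * (\<Prod>i<j. m + Suc i)" for m j :: nat
  by (induction j) (auto simp: algebra_simps)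

text \<open>With \<open>k = Suc j\<close>, pairing the offset \<open>a = Suc i\<close> with its
  mirror image \<open>k - a\<close> gives \<open>(k * n + a) * (k * n + k - a) = k ^ 2 * n * (n + 1)
  + a * (k - a)\<close>, whose last term is nonnegative.\<close>

lemma multinomial_step:
  "(Suc j) ^ (2 * j) * (n * (n + 1)) ^ j \<le> (\<Prod>i<j. Suc j * n + Suc i) ^ 2"
proof -
  have "(\<Prod>i<j. Suc j * n + Suc i) = (\<Prod>i<j. Suc j * n + Suc (j - Suc i))"
    using prod.nat_diff_reindex[of "\<lambda>i. Suc j * n + Suc i" j] by simp
  then have "(\<Prod>i<j. Suc j * n + Suc i) ^ 2
      = (\<Prod>i<j. (Suc j * n + Suc i) * (Suc j * n + Suc (j - Suc i)))"
    by (simp only: power2_eq_square prod.distrib)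
  moreover have "(\<Prod>i<j. (Suc j) ^ 2 * (n * (n + 1)))
      \<le> (\<Prod>i<j. (Suc j * n + Suc i) * (Suc j * n + Suc (j - Suc i)))"
  proof (rule prod_mono)
    fix i assume "i \<in> {..<j}"
    then obtain d where d: "j = Suc i + d" using less_imp_Suc_add by (metis add_Suc lessThan_iff)
    show "0 \<le> (Suc j) ^ 2 * (n * (n + 1)) \<and> (Suc j) ^ 2 * (n * (n + 1))
        \<le> (Suc j * n + Suc i) * (Suc j * n + Suc (j - Suc i))"
      by (simp add: d power2_eq_square algebra_simps)
  qed
  ultimately show ?thesis
    by (simp add: power_mult power_mult_distrib)
qed

text \<open>The quotient of consecutive values of \<open>(k n)!\<^sup>2 n ^ (k - 1) / (n! ^ (2 k) k ^ (2 k n))\<close>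
  is at least 1, so that the value at \<open>n = 1\<close> is a lower bound.\<close>
lemma multinomial_lower_bound:
  assumes "0 < k" "0 < n"
  shows "(fact k)\<^sup>2 * k ^ (2 * (k * n)) * fact n ^ (2 * k)
    \<le> (fact (k * n))\<^sup>2 * n ^ (k - 1) * (k ^ (2 * k) :: nat)"
proof -
  obtain j where k: "k = Suc j" using assms(1) gr0_implies_Suc by blast
  have "(fact k)\<^sup>2 * k ^ (2 * (k * Suc m)) * fact (Suc m) ^ (2 * k)
    \<le> (fact (k * Suc m))\<^sup>2 * Suc m ^ j * (k ^ (2 * k) :: nat)" for m
  proof (induction m)
    case (Suc m)
    let ?n = "Suc m"
    let ?P = "\<Prod>i<j. k * ?n + Suc i"
    \<comment> \<open>The last of the \<open>k\<close> new factors is kept apart, leaving the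
      \<open>j\<close> factors of \<open>multinomial_step\<close>.\<close>
    have fact_k: "(fact (k * Suc ?n) :: nat) = fact (k * ?n) * ?P * (k * Suc ?n)"
      using fact_add_eq_prod[of "k * ?n" k] by (simp add: k algebra_simps)
    have fact_n: "(fact (Suc ?n) :: nat) = Suc ?n * fact ?n" by simp
    \<comment> \<open>Multiplying by \<open>?n ^ j\<close> avoids a quotient; this positive factor
      cancels at the end.\<close>
    have "(fact k)\<^sup>2 * k ^ (2 * (k * Suc ?n)) * (fact (Suc ?n)) ^ (2 * k) * ?n ^ j
        = ((fact k)\<^sup>2 * k ^ (2 * (k * ?n)) * fact ?n ^ (2 * k)) *
          (k ^ (2 * k) * Suc ?n ^ (2 * k) * ?n ^ j)"
    proof -
      have "k ^ (2 * (k * Suc ?n)) = k ^ (2 * (k * ?n)) * k ^ (2 * k)"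
        by (simp only: power_add[symmetric] mult_Suc_right distrib_left ac_simps)
      then show ?thesis unfolding fact_n by (simp only: power_mult_distrib ac_simps)
    qed
    also have "\<dots> \<le> ((fact (k * ?n))\<^sup>2 * ?n ^ j * k ^ (2 * k)) *
          (k ^ (2 * k) * Suc ?n ^ (2 * k) * ?n ^ j)"
      by (rule mult_right_mono[OF Suc.IH]) simp
    also have "k ^ (2 * k) * Suc ?n ^ (2 * k) * ?n ^ j
        = (k * Suc ?n)\<^sup>2 * Suc ?n ^ j * (Suc j ^ (2 * j) * (?n * (?n + 1)) ^ j)"
    proof -
      have "a ^ (2 * Suc j) * d ^ (2 * Suc j) * c ^ j
          = (a * d)\<^sup>2 * d ^ j * (a ^ (2 * j) * (c * d) ^ j)" for a c d :: nat
        by (simp add: power_mult_distrib mult_2 mult_2_right power_add power2_eq_square ac_simps)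
      from this[of k "Suc ?n" ?n] show ?thesis by (simp only: k Suc_eq_plus1)
    qed
    also have "((fact (k * ?n))\<^sup>2 * ?n ^ j * k ^ (2 * k)) * \<dots>
        \<le> ((fact (k * ?n))\<^sup>2 * ?n ^ j * k ^ (2 * k)) * ((k * Suc ?n)\<^sup>2 * Suc ?n ^ j * ?P ^ 2)"
      using multinomial_step[of j ?n] unfolding k by (intro mult_left_mono) auto
    also have "\<dots> = (fact (k * Suc ?n))\<^sup>2 * Suc ?n ^ j * k ^ (2 * k) * ?n ^ j"
      unfolding fact_k by (simp only: power_mult_distrib ac_simps)
    finally show ?case by (simp del: fact_Suc)
  qed (simp add: k)
  from this[of "n - 1"] show ?thesis using assms(2) k by simp
qed

section \<open>The random graph\<close>

lemma sum_Pow_binomial: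
  fixes x y :: "'a :: comm_semiring_1"
  assumes "finite S"
  shows "(\<Sum>H\<in>Pow S. x ^ card H * y ^ (card S - card H)) = (x + y) ^ card S"
proof -
  have "(x + y) ^ card S = (\<Sum>H\<in>Pow S. (\<Prod>_\<in>H. x) * (\<Prod>_\<in>S - H. y))"
    using prod_add[OF assms, of "\<lambda>_. x" "\<lambda>_. y"] by simp
  also have "\<dots> = (\<Sum>H\<in>Pow S. x ^ card H * y ^ (card S - card H))"
    using assms by (intro sum.cong) (auto simp: card_Diff_subset finite_subset)
  finally show ?thesis by simp
qed

lemma sum_Pow_power:
  fixes x :: "'a :: comm_semiring_1"
  assumes "finite S"
  shows "(\<Sum>H\<in>Pow S. x ^ card H) = (1 + x) ^ card S"
  using sum_Pow_binomial[OF assms, of x 1] by (simp add: add.commute)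

lemma finite_all_edges: "finite (all_edges N)"
  by (simp add: all_edges_eq finite_edges_on)

text \<open>The probability that the random graph contains \<open>A\<close>: the edges outside
  \<open>A\<close> are free, and their weights sum to a power of
  \<open>p + (1 - p) = 1\<close>.\<close>

lemma sum_gnp_weight_superset:
  assumes "A \<subseteq> all_edges N"
  shows "(\<Sum>G | G \<subseteq> all_edges N \<and> A \<subseteq> G. gnp_weight N p G) = p ^ card A"
proof -
  let ?E = "all_edges N"
  have finA: "finite A" using assms finite_all_edges finite_subset by blast
  have "(\<Sum>G | G \<subseteq> ?E \<and> A \<subseteq> G. gnp_weight N p G)
      = (\<Sum>H\<in>Pow (?E - A). p ^ card A * (p ^ card H * (1 - p) ^ (card (?E - A) - card H)))"
  proof (rule sum.reindex_bij_witness[of _ "\<lambda>H. A \<union> H" "\<lambda>G. G - A"])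
    fix G assume "G \<in> {G. G \<subseteq> ?E \<and> A \<subseteq> G}"
    then have G: "G \<subseteq> ?E" "A \<subseteq> G" by auto
    then have "finite G" using finite_all_edges finite_subset by blast
    then have "card G = card A + card (G - A)"
      using G(2) finA card_Diff_subset[of A G] card_mono[of G A] by simp
    moreover have "card ?E = card A + card (?E - A)"
      using assms finA card_Diff_subset[of A ?E] card_mono[of ?E A] finite_all_edges by simp
    ultimately show "p ^ card A * (p ^ card (G - A) * (1 - p) ^ (card (?E - A) - card (G - A)))
        = gnp_weight N p G"
      unfolding gnp_weight_def by (simp add: power_add)
  qed (use assms in auto)
  also have "\<dots> = p ^ card A * (p + (1 - p)) ^ card (?E - A)"
    using finite_all_edges by (simp only: sum_distrib_left[symmetric] sum_Pow_binomial finite_Diff)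
  finally show ?thesis by simp
qed

text \<open>Linearity of expectation.\<close>

lemma sum_gnp_weight_count:
  assumes "finite I" "\<And>i. i \<in> I \<Longrightarrow> f i \<subseteq> all_edges N"
  shows "(\<Sum>G\<in>Pow (all_edges N). gnp_weight N p G * real (card {i \<in> I. f i \<subseteq> G}))
    = (\<Sum>i\<in>I. p ^ card (f i))"
proof -
  let ?E = "all_edges N"
  have "(\<Sum>G\<in>Pow ?E. gnp_weight N p G * real (card {i \<in> I. f i \<subseteq> G}))
      = (\<Sum>G\<in>Pow ?E. \<Sum>i\<in>I. if f i \<subseteq> G then gnp_weight N p G else 0)"
  proof (rule sum.cong[OF refl])
    fix G
    have "(\<Sum>i\<in>I. if f i \<subseteq> G then gnp_weight N p G else 0)
        = (\<Sum>i\<in>{i \<in> I. f i \<subseteq> G}. gnp_weight N p G)"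
      by (rule sum.inter_filter[OF assms(1), symmetric])
    then show "gnp_weight N p G * real (card {i \<in> I. f i \<subseteq> G})
        = (\<Sum>i\<in>I. if f i \<subseteq> G then gnp_weight N p G else 0)" by simp
  qed
  also have "\<dots> = (\<Sum>i\<in>I. \<Sum>G\<in>Pow ?E. if f i \<subseteq> G then gnp_weight N p G else 0)"
    by (rule sum.swap)
  also have "\<dots> = (\<Sum>i\<in>I. p ^ card (f i))"
  proof (rule sum.cong[OF refl])
    fix i assume i: "i \<in> I"
    have "(\<Sum>G\<in>Pow ?E. if f i \<subseteq> G then gnp_weight N p G else 0)
        = (\<Sum>G\<in>{G \<in> Pow ?E. f i \<subseteq> G}. gnp_weight N p G)"
      using finite_all_edges by (intro sum.inter_filter[symmetric]) simp
    also have "{G \<in> Pow ?E. f i \<subseteq> G} = {G. G \<subseteq> ?E \<and> f i \<subseteq> G}" by auto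
    finally show "(\<Sum>G\<in>Pow ?E. if f i \<subseteq> G then gnp_weight N p G else 0) = p ^ card (f i)"
      using sum_gnp_weight_superset[OF assms(2)[OF i]] by simp
  qed
  finally show ?thesis .
qed

lemma card_tree:
  assumes "0 < N" "is_tree {0..<N} T"
  shows "card T = N - 1"
proof -
  have "card T + card (components {0..<N} T) = N"
    using assms(2) is_tree_iff[of "{0..<N}" T] by (simp add: forest_def)
  then show ?thesis using card_components_tree[OF _ _ assms(2)] assms(1) by simp
qed

text \<open>The left-hand side is \<open>p ^ (1 - N)\<close> times the expected number of spanning trees of
  \<open>G(N,p)\<close> conditioned on \<open>T \<subseteq> G\<close>.\<close>
lemma sum_overlap_le:
  assumes "0 < N" "0 < p" "p \<le> 1" "is_tree {0..<N} T"
  shows "(\<Sum>T' | is_tree {0..<N} T'. (1 / p) ^ card (T \<inter> T'))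
    \<le> real N ^ N / real N ^ 2 * exp (2 * (1 / p - 1))"
proof -
  let ?V = "{0..<N}" and ?B = "real N ^ N / real N ^ 2"
  define q where "q = 1 / p - 1"
  have q: "0 \<le> q" "1 / p = 1 + q" using assms by (auto simp: q_def)
  have forestT: "forest ?V T" using assms(4) is_tree_iff[of ?V] by simp
  then have finT: "finite T" using forest_finite[of ?V] by simp
  have fin: "finite {T'. is_tree ?V T'}" by (rule finite_trees) simp
  have "(\<Sum>T' | is_tree ?V T'. (1 / p) ^ card (T \<inter> T'))
      = (\<Sum>T' | is_tree ?V T'. \<Sum>F\<in>Pow T. if F \<subseteq> T' then q ^ card F else 0)"
  proof (rule sum.cong[OF refl])
    fix T'
    have "(\<Sum>F\<in>Pow T. if F \<subseteq> T' then q ^ card F else 0) = (\<Sum>F\<in>{F \<in> Pow T. F \<subseteq> T'}. q ^ card F)"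
      using finT by (intro sum.inter_filter[symmetric]) simp
    also have "{F \<in> Pow T. F \<subseteq> T'} = Pow (T \<inter> T')" by auto
    also have "(\<Sum>F\<in>Pow (T \<inter> T'). q ^ card F) = (1 / p) ^ card (T \<inter> T')"
      unfolding q(2) using finT by (intro sum_Pow_power) simp
    finally show "(1 / p) ^ card (T \<inter> T') = (\<Sum>F\<in>Pow T. if F \<subseteq> T' then q ^ card F else 0)" ..
  qed
  also have "\<dots> = (\<Sum>F\<in>Pow T. \<Sum>T' | is_tree ?V T'. if F \<subseteq> T' then q ^ card F else 0)"
    by (rule sum.swap)
  also have "\<dots> = (\<Sum>F\<in>Pow T. q ^ card F * real (card {T'. F \<subseteq> T' \<and> is_tree ?V T'}))"
  proof (rule sum.cong[OF refl])
    fix F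
    have "(\<Sum>T' | is_tree ?V T'. if F \<subseteq> T' then q ^ card F else 0)
        = (\<Sum>T'\<in>{T' \<in> {T'. is_tree ?V T'}. F \<subseteq> T'}. q ^ card F)"
      using fin by (intro sum.inter_filter[symmetric])
    also have "{T' \<in> {T'. is_tree ?V T'}. F \<subseteq> T'} = {T'. F \<subseteq> T' \<and> is_tree ?V T'}" by auto
    finally show "(\<Sum>T' | is_tree ?V T'. if F \<subseteq> T' then q ^ card F else 0)
        = q ^ card F * real (card {T'. F \<subseteq> T' \<and> is_tree ?V T'})" by simp
  qed
  also have "\<dots> \<le> (\<Sum>F\<in>Pow T. q ^ card F * (?B * (2 / real N) ^ card F))"
  proof (intro sum_mono mult_left_mono)
    fix F assume "F \<in> Pow T"
    then have "forest ?V F" using forestT forest_subset[of ?V T F] by simp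
    then show "real (card {T'. F \<subseteq> T' \<and> is_tree ?V T'}) \<le> ?B * (2 / real N) ^ card F"
      using card_trees_containing_le[of ?V F] assms(1) by simp
  qed (use q in simp)
  also have "\<dots> = ?B * (\<Sum>F\<in>Pow T. (2 * q / real N) ^ card F)"
    unfolding sum_distrib_left
    by (intro sum.cong refl) (simp add: power_divide power_mult_distrib)
  also have "\<dots> \<le> ?B * exp (2 * q)"
  proof (rule mult_left_mono)
    have "(\<Sum>F\<in>Pow T. (2 * q / real N) ^ card F) = (1 + 2 * q / real N) ^ card T"
      by (rule sum_Pow_power[OF finT])
    \<comment> \<open>\<open>T\<close> has \<open>N - 1\<close> edges; the exponent is raised to
      \<open>N\<close> so that it cancels the denominator inside \<open>exp\<close>.\<close>
    also have "\<dots> \<le> (1 + 2 * q / real N) ^ N"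
      using card_tree[OF assms(1,4)] q by (intro power_increasing) auto
    also have "\<dots> \<le> exp (2 * q / real N) ^ N"
      using q by (intro power_mono exp_ge_add_one_self) auto
    also have "\<dots> = exp (2 * q)"
      using assms(1) by (simp add: exp_of_nat_mult[symmetric])
    finally show "(\<Sum>F\<in>Pow T. (2 * q / real N) ^ card F) \<le> exp (2 * q)" .
  qed simp
  finally show ?thesis by (simp only: q_def)
qed

section \<open>The moment bound for the splitting probability\<close>

lemma gnp_weight_nonneg: "0 \<le> p \<Longrightarrow> p \<le> 1 \<Longrightarrow> 0 \<le> gnp_weight N p G"
  by (simp add: gnp_weight_def)

lemma tau_eq: "G \<subseteq> all_edges N \<Longrightarrow> tau N G = card {T \<in> {T. is_tree {0..<N} T}. T \<subseteq> G}"
  unfolding tau_def spanning_trees_def by (rule arg_cong[of _ _ card]) auto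

lemma tau_k_eq:
  "G \<subseteq> all_edges N \<Longrightarrow>
    tau_k k N G = card {T \<in> {T. is_tree {0..<N} T \<and> k_splittable k {0..<N} T}. T \<subseteq> G}"
  unfolding tau_k_def spanning_trees_def by (rule arg_cong[of _ _ card]) auto

lemma tau_k_le_tau: "tau_k k N G \<le> tau N G"
proof -
  have "finite (spanning_trees N G)"
    by (rule finite_subset[OF _ finite_trees[of "{0..<N}"]]) (auto simp: spanning_trees_def)
  then show ?thesis unfolding tau_k_def tau_def by (intro card_mono) auto
qed

lemma connected_if_spanning_tree:
  assumes "tau N G \<noteq> 0" "G \<subseteq> all_edges N"
  shows "G \<in> connected_graphs N"
proof -
  obtain T where "T \<subseteq> G" "is_tree {0..<N} T"
    using assms(1) unfolding tau_def spanning_trees_def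
    by (metis (no_types, lifting) card_eq_0_iff equals0I mem_Collect_eq)
  then have "\<forall>u\<in>{0..<N}. \<forall>v\<in>{0..<N}. (u, v) \<in> conn {0..<N} G"
    using is_tree_iff[of "{0..<N}" T] conn_mono[of T G "{0..<N}"] by blast
  then show ?thesis
    using assms(2) by (simp add: connected_graphs_def connected_graph_def conn_def)
qed

lemma all_edges_connected: "all_edges N \<in> connected_graphs N"
proof -
  have "(u, v) \<in> (adj_rel {0..<N} (all_edges N))\<^sup>*" if "u < N" "v < N" for u v
    using that by (cases "u = v") (auto simp: adj_rel_def all_edges_def)
  then show ?thesis by (simp add: connected_graphs_def connected_graph_def)
qed

theorem splittable_prob_ge:
  assumes "0 < N" "0 < p" "p \<le> 1"
  shows "real (tau_k k N (all_edges N)) / (real N ^ N / real N ^ 2) * exp (- 2 * (1 / p - 1))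
    \<le> splittable_prob k N p"
proof -
  let ?V = "{0..<N}" and ?E = "all_edges N"
  define S where "S = {T. is_tree ?V T \<and> k_splittable k ?V T}"
  define R where "R = {T. is_tree ?V T}"
  define B where "B = real N ^ N / real N ^ 2 * exp (2 * (1 / p - 1))"
  define \<pi> where "\<pi> = p ^ (N - 1)"
  define w where "w = gnp_weight N p"
  define t where "t G = real (tau N G)" for G
  define s where "s G = real (tau_k k N G)" for G
  have B: "0 < B" using assms by (simp add: B_def)
  have \<pi>: "0 < \<pi>" using assms by (simp add: \<pi>_def)
  have finR: "finite R" unfolding R_def by (rule finite_trees) simp
  have SR: "S \<subseteq> R" by (auto simp: S_def R_def)
  have finS: "finite S" using finite_subset[OF SR finR] .
  have R_edges: "T \<subseteq> ?E" if "T \<in> R" for T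
    using that tree_subset_edges by (simp add: R_def all_edges_eq)
  have card_R: "card T = N - 1" if "T \<in> R" for T
    using that card_tree[OF assms(1)] by (simp add: R_def)
  have w: "0 \<le> w G" for G using assms by (simp add: w_def gnp_weight_nonneg)
  have fin: "finite (Pow ?E)" using finite_all_edges by simp
  have s_eq: "s G = real (card {T \<in> S. T \<subseteq> G})" if "G \<subseteq> ?E" for G
    using tau_k_eq[OF that, of k] by (simp add: s_def S_def)
  have t_eq: "t G = real (card {T \<in> R. T \<subseteq> G})" if "G \<subseteq> ?E" for G
    using tau_eq[OF that] by (simp add: t_def R_def)
  have st: "s G \<le> t G" for G by (simp add: s_def t_def tau_k_le_tau)
  have sE: "s ?E = real (card S)"
  proof -
    have "{T \<in> S. T \<subseteq> ?E} = S" using SR R_edges by auto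
    then show ?thesis using s_eq[of ?E] by simp
  qed

  have first: "(\<Sum>G\<in>Pow ?E. w G * s G) = \<pi> * real (card S)"
  proof -
    have "(\<Sum>G\<in>Pow ?E. w G * s G) = (\<Sum>G\<in>Pow ?E. gnp_weight N p G * real (card {T \<in> S. T \<subseteq> G}))"
      by (intro sum.cong) (auto simp: w_def s_eq)
    also have "\<dots> = (\<Sum>T\<in>S. p ^ card T)"
      using SR R_edges by (intro sum_gnp_weight_count finS) auto
    also have "\<dots> = (\<Sum>T\<in>S. \<pi>)"
      using SR card_R by (intro sum.cong) (auto simp: \<pi>_def)
    finally show ?thesis by simp
  qed

  \<comment> \<open>The expected number of pairs of trees inside \<open>G\<close>: a pair occurs
    with probability \<open>p ^ card (T \<union> T')\<close>, and the union has
    \<open>2 * (N - 1) - card (T \<inter> T')\<close> edges.\<close>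
  have second: "(\<Sum>G\<in>Pow ?E. w G * (s G * t G)) \<le> \<pi> ^ 2 * B * real (card S)"
  proof -
    have "(\<Sum>G\<in>Pow ?E. w G * (s G * t G))
        = (\<Sum>G\<in>Pow ?E. gnp_weight N p G * real (card {x \<in> S \<times> R. fst x \<union> snd x \<subseteq> G}))"
    proof (intro sum.cong refl)
      fix G assume G: "G \<in> Pow ?E"
      have "{x \<in> S \<times> R. fst x \<union> snd x \<subseteq> G} = {T \<in> S. T \<subseteq> G} \<times> {T \<in> R. T \<subseteq> G}" by auto
      then show "w G * (s G * t G)
          = gnp_weight N p G * real (card {x \<in> S \<times> R. fst x \<union> snd x \<subseteq> G})"
        using G s_eq t_eq by (simp add: w_def card_cartesian_product)
    qed
    also have "\<dots> = (\<Sum>x\<in>S \<times> R. p ^ card (fst x \<union> snd x))"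
    proof (rule sum_gnp_weight_count)
      fix x assume "x \<in> S \<times> R"
      then have "fst x \<in> R" "snd x \<in> R" using SR by auto
      then show "fst x \<union> snd x \<subseteq> ?E" using R_edges by (simp add: Un_least)
    qed (use finS finR in simp)
    also have "\<dots> = (\<Sum>T\<in>S. \<Sum>T'\<in>R. p ^ card (T \<union> T'))"
      by (simp add: sum.cartesian_product case_prod_unfold)
    also have "\<dots> \<le> (\<Sum>T\<in>S. \<pi> ^ 2 * B)"
    proof (rule sum_mono)
      fix T assume "T \<in> S"
      then have T: "T \<in> R" using SR by auto
      have "p ^ card (T \<union> T') = \<pi> ^ 2 * (1 / p) ^ card (T \<inter> T')" if "T' \<in> R" for T'
      proof -
        have "finite T" "finite T'"
          using R_edges T that finite_all_edges finite_subset by metis+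
        then have "card (T \<union> T') + card (T \<inter> T') = (N - 1) * 2"
          using card_Un_Int[of T T'] card_R T that by simp
        then have "p ^ card (T \<union> T') * p ^ card (T \<inter> T') = \<pi> ^ 2"
          unfolding \<pi>_def by (simp only: power_add[symmetric] power_mult[symmetric])
        then show ?thesis using assms(2) by (simp add: power_one_over field_simps)
      qed
      then have "(\<Sum>T'\<in>R. p ^ card (T \<union> T')) = \<pi> ^ 2 * (\<Sum>T'\<in>R. (1 / p) ^ card (T \<inter> T'))"
        by (simp add: sum_distrib_left)
      also have "(\<Sum>T'\<in>R. (1 / p) ^ card (T \<inter> T')) \<le> B"
        unfolding R_def B_def using T by (intro sum_overlap_le assms) (simp add: R_def)
      finally show "(\<Sum>T'\<in>R. p ^ card (T \<union> T')) \<le> \<pi> ^ 2 * B" by (simp add: mult_left_mono)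
    qed
    finally show ?thesis by (simp add: mult.commute)
  qed

  \<comment> \<open>This value maximises \<open>2 * L * \<pi> - L ^ 2 * \<pi> ^ 2 * B\<close>, the
    lower bound obtained per splittable tree.\<close>
  define L where "L = 1 / (\<pi> * B)"
  \<comment> \<open>AM-GM: \<open>2 L \<le> 1 / t + L\<^sup>2 t\<close>\<close>
  have pointwise: "2 * L * s G - L ^ 2 * (s G * t G) \<le> s G / t G" for G
  proof (cases "t G = 0")
    case True
    then have "s G = 0" using st[of G] by (simp add: s_def)
    then show ?thesis by simp
  next
    case False
    then have t: "0 < t G" by (simp add: t_def)
    have "s G / t G - (2 * L * s G - L ^ 2 * (s G * t G)) = s G * (1 - L * t G) ^ 2 / t G"
      using t by (simp add: field_simps power2_eq_square)
    also have "\<dots> \<ge> 0" using t by (simp add: s_def)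
    finally show ?thesis by simp
  qed
  have "real (card S) / B = 2 * L * (\<pi> * real (card S)) - L ^ 2 * (\<pi> ^ 2 * B * real (card S))"
    using B \<pi> by (simp add: L_def field_simps power2_eq_square)
  also have "\<dots> \<le> 2 * L * (\<Sum>G\<in>Pow ?E. w G * s G) - L ^ 2 * (\<Sum>G\<in>Pow ?E. w G * (s G * t G))"
    using second by (simp add: first mult_left_mono)
  also have "\<dots> = (\<Sum>G\<in>Pow ?E. w G * (2 * L * s G - L ^ 2 * (s G * t G)))"
    by (simp add: sum_distrib_left sum_subtractf algebra_simps)
  also have "\<dots> \<le> (\<Sum>G\<in>Pow ?E. w G * (s G / t G))"
    by (intro sum_mono mult_left_mono pointwise w)
  \<comment> \<open>Disconnected graphs have no spanning tree, and division by zero makes their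
    terms 0.\<close>
  also have "\<dots> = (\<Sum>G\<in>connected_graphs N. w G * (s G / t G))"
  proof (rule sum.mono_neutral_right[OF fin])
    show "\<forall>G\<in>Pow ?E - connected_graphs N. w G * (s G / t G) = 0"
      using connected_if_spanning_tree by (auto simp: t_def)
  qed (auto simp: connected_graphs_def)
  finally have num: "real (card S) / B \<le> (\<Sum>G\<in>connected_graphs N. w G * (s G / t G))" .

  \<comment> \<open>\<open>?D\<close> is the probability of being connected. It is positive and at
    most 1, so conditioning cannot decrease the nonnegative sum.\<close>
  let ?D = "\<Sum>G\<in>connected_graphs N. w G"
  have sub: "connected_graphs N \<subseteq> Pow ?E" by (auto simp: connected_graphs_def)
  have "?D \<le> (\<Sum>G\<in>Pow ?E. w G)"
    using w by (intro sum_mono2[OF fin sub])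
  also have "\<dots> = 1"
    using sum_gnp_weight_superset[of "{}" N p] by (simp add: w_def Pow_def)
  finally have D1: "?D \<le> 1" .
  \<comment> \<open>The complete graph has positive weight even for \<open>p = 1\<close>, since
    \<open>0 ^ 0 = 1\<close>.\<close>
  have "0 < w ?E" using assms by (simp add: w_def gnp_weight_def)
  also have "w ?E \<le> ?D"
    using w by (intro member_le_sum all_edges_connected finite_subset[OF sub fin])
  finally have D0: "0 < ?D" .
  have "real (card S) / B \<le> (\<Sum>G\<in>connected_graphs N. w G * (s G / t G)) / ?D"
  proof -
    have "0 \<le> (\<Sum>G\<in>connected_graphs N. w G * (s G / t G))"
      using w by (intro sum_nonneg) (auto simp: s_def t_def)
    then have "(\<Sum>G\<in>connected_graphs N. w G * (s G / t G))
        \<le> (\<Sum>G\<in>connected_graphs N. w G * (s G / t G)) / ?D"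
      using D0 D1 by (simp add: le_divide_eq mult_left_le)
    then show ?thesis using num by simp
  qed
  also have "\<dots> = splittable_prob k N p"
    by (simp add: splittable_prob_def w_def s_def t_def)
  finally have "real (card S) / B \<le> splittable_prob k N p" .
  moreover have "exp (- 2 * (1 / p - 1)) = 1 / exp (2 * (1 / p - 1))"
    by (simp only: mult_minus_left exp_minus inverse_eq_divide)
  ultimately show ?thesis
    using sE by (simp add: B_def s_def)
qed

text \<open>The proportion of splittable trees is at least \<open>M / k ^ N\<close>, the probability
  that a uniformly random labelling of the vertices by \<open>k\<close> labels is balanced;
  \<open>multinomial_lower_bound\<close> estimates it without Stirling's formula.\<close>

lemma splittable_ratio_ge:
  assumes "0 < n" "0 < k"
  defines "N \<equiv> k * n"
  shows "fact k / real k ^ k * real n powr ((1 - real k) / 2)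
    \<le> real (tau_k k N (all_edges N)) / (real N ^ N / real N ^ 2)"
proof -
  define M where "M = real (card (permutations_of_multiset (equal_blocks k n)))"
  have pos: "0 < real n" "0 < real k" "0 < real N" using assms by auto
  have M: "M * fact n ^ k = fact N"
    unfolding M_def N_def using card_permutations_equal_blocks[OF assms(1), of k]
    by (metis of_nat_fact of_nat_mult of_nat_power)
  \<comment> \<open>Squaring removes the half-integral exponent and matches the form of
    \<open>multinomial_lower_bound\<close>.\<close>
  have lower: "(fact k / real k ^ k * real n powr ((1 - real k) / 2))\<^sup>2 \<le> (M / real k ^ N)\<^sup>2"
  proof -
    have "real ((fact k)\<^sup>2 * k ^ (2 * (k * n)) * fact n ^ (2 * k))
        \<le> real ((fact (k * n))\<^sup>2 * n ^ (k - 1) * k ^ (2 * k))"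
      using multinomial_lower_bound[OF assms(2,1)] by (simp only: of_nat_le_iff)
    then have "(fact k)\<^sup>2 * (real k ^ N)\<^sup>2 * (fact n ^ k)\<^sup>2
        \<le> (fact N)\<^sup>2 * real n ^ (k - 1) * (real k ^ k)\<^sup>2"
      by (simp add: N_def power_mult[symmetric] mult.commute)
    also have "\<dots> = M\<^sup>2 * real n ^ (k - 1) * (real k ^ k)\<^sup>2 * (fact n ^ k)\<^sup>2"
      unfolding M[symmetric] by (simp add: power_mult_distrib)
    finally have *: "(fact k)\<^sup>2 * (real k ^ N)\<^sup>2 \<le> M\<^sup>2 * real n ^ (k - 1) * (real k ^ k)\<^sup>2"
      by simp
    have "(real n powr ((1 - real k) / 2))\<^sup>2 = real n powr (- real (k - 1))"
      using pos assms(2) by (simp add: power2_eq_square powr_add[symmetric] of_nat_diff)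
    also have "\<dots> = 1 / real n ^ (k - 1)"
      using powr_minus[of "real n" "real (k - 1)"] powr_realpow[OF pos(1), of "k - 1"]
      by (simp only: inverse_eq_divide)
    finally have "(fact k / real k ^ k * real n powr ((1 - real k) / 2))\<^sup>2
        = (fact k)\<^sup>2 / ((real k ^ k)\<^sup>2 * real n ^ (k - 1))"
      by (simp add: power_mult_distrib power_divide)
    also have "\<dots> \<le> M\<^sup>2 / (real k ^ N)\<^sup>2"
      using * pos by (simp add: divide_le_eq le_divide_eq field_simps)
    finally show ?thesis by (simp add: power_divide)
  qed
  have "fact k / real k ^ k * real n powr ((1 - real k) / 2) \<le> M / real k ^ N"
    by (rule power2_le_imp_le[OF lower]) (simp add: M_def)
  \<comment> \<open>The lower bound for the number of equal forests, times the number of trees over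
    each, divided by the number of all trees; with \<open>N = k * n\<close> the extra powers
    cancel.\<close>
  also have "\<dots> = M * real n ^ N / (real k ^ k * real n ^ (2 * k)) *
      (real N ^ k * real n ^ k / real N ^ 2) / (real N ^ N / real N ^ 2)"
  proof -
    have "real N ^ N = real k ^ N * real n ^ N" "real N ^ k = real k ^ k * real n ^ k"
      by (simp_all add: N_def power_mult_distrib)
    moreover have "real n ^ (2 * k) = real n ^ k * real n ^ k"
      by (simp add: mult_2 power_add)
    ultimately show ?thesis using pos by (simp add: field_simps)
  qed
  also have "\<dots> \<le> real (card (equal_forests {0..<N} n)) *
      (real N ^ k * real n ^ k / real N ^ 2) / (real N ^ N / real N ^ 2)"
  proof (intro divide_right_mono mult_right_mono)
    show "M * real n ^ N / (real k ^ k * real n ^ (2 * k))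
        \<le> real (card (equal_forests {0..<N} n))"
      using card_equal_forests_ge[OF assms(1,2)] pos
      by (simp add: M_def N_def divide_le_eq mult.assoc)
  qed auto
  also have "\<dots> \<le> real (tau_k k N (all_edges N)) / (real N ^ N / real N ^ 2)"
    unfolding N_def using tau_k_complete_ge[OF assms(1,2)] by (intro divide_right_mono) auto
  finally show ?thesis .
qed

text \<open>The bounds hold with error term \<open>\<epsilon> = 0\<close>, constant
  \<open>C = fact k / k ^ k\<close>, \<open>n0 = 2\<close> and \<open>K = 2 / c - 1 / 2\<close>; of
  these only \<open>K\<close> depends on \<open>c\<close>.\<close>

theorem theorem5:
  fixes k :: nat
  assumes "k \<ge> 2"
  shows "\<exists>C > 0. \<forall>c > 0. \<exists>\<epsilon> :: nat \<Rightarrow> real. \<epsilon> \<longlonglongrightarrow> 0 \<and> (\<exists>K :: real. \<exists>n0 :: nat.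
     \<forall>n \<ge> n0. \<forall>p :: real. c / ln (real n) \<le> p \<and> p \<le> 1 \<longrightarrow>
       splittable_prob k (k * n) p \<ge>
         C * real n powr ((1 - real k) / 2) * p * exp (- (2 + \<epsilon> n) / p)
     \<and> splittable_prob k (k * n) p \<ge> C * real n powr (- real k / 2 - K))"
proof -
  define C :: real where "C = fact k / real k ^ k"
  have C: "0 < C" using assms by (simp add: C_def)
  have main: "C * real n powr ((1 - real k) / 2) * exp (- 2 / p) \<le> splittable_prob k (k * n) p"
    if "0 < n" "0 < p" "p \<le> 1" for n p
  proof -
    \<comment> \<open>The simpler \<open>exp (- 2 / p)\<close> is smaller than
      \<open>exp (- 2 * (1 / p - 1))\<close> by the factor \<open>exp 2\<close>.\<close>
    have "C * real n powr ((1 - real k) / 2) * exp (- 2 / p)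
        \<le> real (tau_k k (k * n) (all_edges (k * n))) / (real (k * n) ^ (k * n) / real (k * n) ^ 2)
          * exp (- 2 * (1 / p - 1))"
      unfolding C_def using splittable_ratio_ge[of n k] that assms
      by (intro mult_mono) auto
    also have "\<dots> \<le> splittable_prob k (k * n) p"
      using that assms by (intro splittable_prob_ge) auto
    finally show ?thesis .
  qed
  have "splittable_prob k (k * n) p \<ge> C * real n powr ((1 - real k) / 2) * p * exp (- (2 + 0) / p)
      \<and> splittable_prob k (k * n) p \<ge> C * real n powr (- real k / 2 - (2 / c - 1 / 2))"
    if c: "0 < c" and n: "2 \<le> n" and p: "c / ln (real n) \<le> p" "p \<le> 1" for c n p
  proof
    \<comment> \<open>A positive logarithm turns the lower bound on \<open>p\<close> into
      \<open>p > 0\<close>.\<close>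
    have ln: "0 < ln (real n)" using n by simp
    then have "0 < c / ln (real n)" using c by simp
    then have p0: "0 < p" using p by linarith
    have m: "C * real n powr ((1 - real k) / 2) * exp (- 2 / p) \<le> splittable_prob k (k * n) p"
      using main[of n p] n p0 p by simp
    have "C * real n powr ((1 - real k) / 2) * p * exp (- (2 + 0) / p)
        \<le> C * real n powr ((1 - real k) / 2) * 1 * exp (- 2 / p)"
      using p p0 C by (intro mult_mono) auto
    then show "C * real n powr ((1 - real k) / 2) * p * exp (- (2 + 0) / p)
        \<le> splittable_prob k (k * n) p" using m by simp
    \<comment> \<open>The lower bound on \<open>p\<close> makes \<open>exp (- 2 / p)\<close> at
      least \<open>n powr (- 2 / c)\<close>; this is the source of \<open>K\<close>.\<close>
    have "2 / p \<le> 2 / c * ln (real n)"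
      using p(1) ln c p0 by (simp add: field_simps)
    then have "real n powr (- 2 / c) \<le> exp (- 2 / p)"
      using n by (simp add: powr_def)
    then have "C * real n powr ((1 - real k) / 2) * real n powr (- 2 / c)
        \<le> C * real n powr ((1 - real k) / 2) * exp (- 2 / p)"
      using C by (intro mult_left_mono) auto
    moreover have "real n powr (- real k / 2 - (2 / c - 1 / 2))
        = real n powr ((1 - real k) / 2) * real n powr (- 2 / c)"
      unfolding powr_add[symmetric]
      by (rule arg_cong[of _ _ "(powr) (real n)"]) (simp add: field_simps)
    ultimately show "C * real n powr (- real k / 2 - (2 / c - 1 / 2)) \<le> splittable_prob k (k * n) p"
      using m by (simp add: mult.assoc)
  qed
  then show ?thesis
    using C
    by (intro exI[of _ C] conjI allI impI exI[of _ "\<lambda>_. 0"] tendsto_const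
        exI[of _ "2 / c - 1 / 2" for c] exI[of _ 2]) auto
qed

end
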